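(* Let $(M,g)$ be a compact, connected, $C^\infty$ Riemannian manifold without boundary of dimension $n\ge2$, let $\psi\in C^\infty(M)$ and $\mathfrak{m}=e^{-\psi}\mathrm{vol}_g$. Suppose that $\mathrm{Ric}_N\ge K$ for some $K>0$ and $N<0$, i.e. $\mathrm{Ric}_N(v)\ge K|v|^2$ for all $v\in TM$. Then the first nonzero eigenvalue of the nonnegative operator $-\Delta_{\mathfrak{m}}$ is bounded from below by $KN/(N-1)$.
   Context: The weighted Laplacian is $\Delta_{\mathfrak{m}}u:=\Delta u-\langle\nabla u,\nabla\psi\rangle$. The weighted Ricci curvature, for $N<0$ and $v\in TM$, is $\mathrm{Ric}_N(v):=\mathrm{Ric}(v)+\mathrm{Hess}\,\psi(v,v)-\frac{\langle\nabla\psi,v\rangle^2}{N-n}$, where $\mathrm{Ric}(v)=\mathrm{Ric}(v,v)$. *)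

theory Defs
  imports "HOL-Analysis.Analysis"
begin

section \<open>Smooth maps between open subsets of normed spaces\<close>

text \<open>
  Being of class C^k on an open set: all iterated directional derivatives up to order k
  exist, the ones of order less than k are (Frechet) differentiable, those of order k are continuous.
  The definition is only meaningful for open S.
\<close>

primrec Ck_on :: "nat \<Rightarrow> 'a::real_normed_vector set \<Rightarrow> ('a \<Rightarrow> 'b::real_normed_vector) \<Rightarrow> bool" where
  "Ck_on 0 S f \<longleftrightarrow> continuous_on S f"
| "Ck_on (Suc k) S f \<longleftrightarrow>
     (\<forall>x\<in>S. f differentiable (at x)) \<and>
     (\<forall>v. Ck_on k S (\<lambda>x. frechet_derivative f (at x) v))"

definition smooth_on :: "'a::real_normed_vector set \<Rightarrow> ('a \<Rightarrow> 'b::real_normed_vector) \<Rightarrow> bool" where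
  "smooth_on S f \<longleftrightarrow> (\<forall>k. Ck_on k S f)"

section \<open>Smooth manifolds without boundary\<close>

text \<open>
  A chart is a pair (U, \<phi>); only the values of \<phi> on U matter. The model space is
  the Euclidean space indexed by 'n, so the dimension of the manifold is CARD('n).
\<close>

type_synonym ('a, 'n) chart = "'a set \<times> ('a \<Rightarrow> real ^ 'n)"

definition chart_image :: "('a, 'n) chart \<Rightarrow> (real ^ 'n) set" where
  "chart_image c = snd c ` fst c"

definition chart_inv :: "('a, 'n) chart \<Rightarrow> real ^ 'n \<Rightarrow> 'a" where
  "chart_inv c = inv_into (fst c) (snd c)"

definition is_chart :: "'a topology \<Rightarrow> ('a, 'n::finite) chart \<Rightarrow> bool" where
  "is_chart X c \<longleftrightarrow>
     openin X (fst c) \<and> open (chart_image c) \<and>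
     homeomorphic_map (subtopology X (fst c)) (top_of_set (chart_image c)) (snd c)"

definition transition :: "('a, 'n) chart \<Rightarrow> ('a, 'n) chart \<Rightarrow> real ^ 'n \<Rightarrow> real ^ 'n" where
  "transition c d = snd d \<circ> chart_inv c"

text \<open>The atlas A need not be maximal; everything below depends only on the smooth structure it generates.\<close>

definition smooth_manifold :: "'a topology \<Rightarrow> ('a, 'n::finite) chart set \<Rightarrow> bool" where
  "smooth_manifold X A \<longleftrightarrow>
     Hausdorff_space X \<and> second_countable X \<and>
     (\<forall>c\<in>A. is_chart X c) \<and>
     (\<Union>c\<in>A. fst c) = topspace X \<and>
     (\<forall>c\<in>A. \<forall>d\<in>A. smooth_on (snd c ` (fst c \<inter> fst d)) (transition c d))"

definition smooth_fun :: "('a, 'n::finite) chart set \<Rightarrow> ('a \<Rightarrow> real) \<Rightarrow> bool" where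
  "smooth_fun A u \<longleftrightarrow> (\<forall>c\<in>A. smooth_on (chart_image c) (u \<circ> chart_inv c))"

section \<open>Riemannian metrics\<close>

text \<open>
  A Riemannian metric is a symmetric positive definite tensor field of type (0,2), given by its
  component matrices: \<open>g c x\<close> is the Gram matrix of the coordinate frame of the chart c at
  the point with coordinates x. The last conjunct is the transformation law of such tensors.
\<close>

definition riemannian_metric ::
    "('a, 'n::finite) chart set \<Rightarrow> (('a, 'n) chart \<Rightarrow> real ^ 'n \<Rightarrow> real ^ 'n ^ 'n) \<Rightarrow> bool" where
  "riemannian_metric A g \<longleftrightarrow>
     (\<forall>c\<in>A. smooth_on (chart_image c) (g c) \<and>
        (\<forall>x\<in>chart_image c. transpose (g c x) = g c x \<and> (\<forall>v. v \<noteq> 0 \<longrightarrow> 0 < v \<bullet> (g c x *v v)))) \<and>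
     (\<forall>c\<in>A. \<forall>d\<in>A. \<forall>p\<in>fst c \<inter> fst d. \<forall>v w.
        v \<bullet> (g c (snd c p) *v w) =
        frechet_derivative (transition c d) (at (snd c p)) v \<bullet>
          (g d (snd d p) *v frechet_derivative (transition c d) (at (snd c p)) w))"

section \<open>Riemannian geometry in local coordinates\<close>

text \<open>
  In this section G is the component matrix of the metric, f and \<psi> are functions and v, w are
  component vectors of tangent vectors, all in one fixed coordinate system.
\<close>

definition pderiv_at :: "'n::finite \<Rightarrow> (real ^ 'n \<Rightarrow> real) \<Rightarrow> real ^ 'n \<Rightarrow> real" where
  "pderiv_at i f x = frechet_derivative f (at x) (axis i 1)"

definition inverse_metric ::
    "(real ^ 'n \<Rightarrow> real ^ 'n ^ 'n) \<Rightarrow> 'n::finite \<Rightarrow> 'n \<Rightarrow> real ^ 'n \<Rightarrow> real" where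
  "inverse_metric G i j x = matrix_inv (G x) $ i $ j"

definition metric_inner :: "(real ^ 'n \<Rightarrow> real ^ 'n ^ 'n) \<Rightarrow> real ^ 'n::finite \<Rightarrow> real ^ 'n \<Rightarrow> real ^ 'n \<Rightarrow> real" where
  "metric_inner G x v w = v \<bullet> (G x *v w)"

text \<open>\<open>christoffel G k i j\<close> is the symbol with upper index k and lower indices i, j.\<close>

definition christoffel ::
    "(real ^ 'n \<Rightarrow> real ^ 'n ^ 'n) \<Rightarrow> 'n::finite \<Rightarrow> 'n \<Rightarrow> 'n \<Rightarrow> real ^ 'n \<Rightarrow> real" where
  "christoffel G k i j x = 1/2 * (\<Sum>l\<in>UNIV. inverse_metric G k l x *
     (pderiv_at i (\<lambda>y. G y $ j $ l) x + pderiv_at j (\<lambda>y. G y $ i $ l) x - pderiv_at l (\<lambda>y. G y $ i $ j) x))"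

text \<open>
  The component along the l-th coordinate field of R(\<open>\<partial>\<close>_i, \<open>\<partial>\<close>_j) \<open>\<partial>\<close>_k, where
  R(X,Y)Z is the commutator of covariant derivatives along X and Y applied to Z, minus the
  covariant derivative along [X,Y].
\<close>

definition riemann_curv ::
    "(real ^ 'n \<Rightarrow> real ^ 'n ^ 'n) \<Rightarrow> 'n::finite \<Rightarrow> 'n \<Rightarrow> 'n \<Rightarrow> 'n \<Rightarrow> real ^ 'n \<Rightarrow> real" where
  "riemann_curv G l i j k x =
     pderiv_at i (christoffel G l j k) x - pderiv_at j (christoffel G l i k) x +
     (\<Sum>m\<in>UNIV. christoffel G m j k x * christoffel G l i m x - christoffel G m i k x * christoffel G l j m x)"

text \<open>Ric(Y,Z) is the trace of X \<open>\<mapsto>\<close> R(X,Y)Z, so that round spheres have positive Ricci curvature.\<close>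

definition ricci :: "(real ^ 'n \<Rightarrow> real ^ 'n ^ 'n) \<Rightarrow> real ^ 'n::finite \<Rightarrow> real ^ 'n \<Rightarrow> real ^ 'n \<Rightarrow> real" where
  "ricci G x v w = (\<Sum>j\<in>UNIV. \<Sum>k\<in>UNIV. (\<Sum>i\<in>UNIV. riemann_curv G i i j k x) * v $ j * w $ k)"

definition gradient :: "(real ^ 'n \<Rightarrow> real ^ 'n ^ 'n) \<Rightarrow> (real ^ 'n \<Rightarrow> real) \<Rightarrow> real ^ 'n::finite \<Rightarrow> real ^ 'n" where
  "gradient G f x = (\<chi> i. \<Sum>j\<in>UNIV. inverse_metric G i j x * pderiv_at j f x)"

definition hessian_comp ::
    "(real ^ 'n \<Rightarrow> real ^ 'n ^ 'n) \<Rightarrow> (real ^ 'n \<Rightarrow> real) \<Rightarrow> 'n::finite \<Rightarrow> 'n \<Rightarrow> real ^ 'n \<Rightarrow> real" where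
  "hessian_comp G f i j x =
     pderiv_at i (pderiv_at j f) x - (\<Sum>k\<in>UNIV. christoffel G k i j x * pderiv_at k f x)"

definition hessian ::
    "(real ^ 'n \<Rightarrow> real ^ 'n ^ 'n) \<Rightarrow> (real ^ 'n \<Rightarrow> real) \<Rightarrow> real ^ 'n::finite \<Rightarrow> real ^ 'n \<Rightarrow> real ^ 'n \<Rightarrow> real" where
  "hessian G f x v w = (\<Sum>i\<in>UNIV. \<Sum>j\<in>UNIV. hessian_comp G f i j x * v $ i * w $ j)"

text \<open>The Laplace-Beltrami operator with the analysts' sign, as the metric trace of the Hessian.\<close>

definition laplacian :: "(real ^ 'n \<Rightarrow> real ^ 'n ^ 'n) \<Rightarrow> (real ^ 'n \<Rightarrow> real) \<Rightarrow> real ^ 'n::finite \<Rightarrow> real" where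
  "laplacian G f x = (\<Sum>i\<in>UNIV. \<Sum>j\<in>UNIV. inverse_metric G i j x * hessian_comp G f i j x)"

definition weighted_laplacian ::
    "(real ^ 'n \<Rightarrow> real ^ 'n ^ 'n) \<Rightarrow> (real ^ 'n \<Rightarrow> real) \<Rightarrow> (real ^ 'n \<Rightarrow> real) \<Rightarrow> real ^ 'n::finite \<Rightarrow> real" where
  "weighted_laplacian G \<psi> f x =
     laplacian G f x - metric_inner G x (gradient G f x) (gradient G \<psi> x)"

definition weighted_ricci ::
    "real \<Rightarrow> (real ^ 'n \<Rightarrow> real ^ 'n ^ 'n) \<Rightarrow> (real ^ 'n \<Rightarrow> real) \<Rightarrow> real ^ 'n::finite \<Rightarrow> real ^ 'n \<Rightarrow> real" where
  "weighted_ricci N G \<psi> x v =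
     ricci G x v v + hessian G \<psi> x v v -
     (metric_inner G x (gradient G \<psi> x) v)\<^sup>2 / (N - real CARD('n))"

section \<open>Curvature bound and eigenvalues on the manifold\<close>

text \<open>
  Since all the quantities above are invariant under changes of coordinates, (in)equalities between
  them on the manifold are expressed by requiring them in every chart of the atlas. A tangent
  vector at a point of the domain of c is its vector v of components in c.
\<close>

definition weighted_ricci_ge ::
    "('a, 'n::finite) chart set \<Rightarrow> (('a, 'n) chart \<Rightarrow> real ^ 'n \<Rightarrow> real ^ 'n ^ 'n) \<Rightarrow> ('a \<Rightarrow> real) \<Rightarrow>
     real \<Rightarrow> real \<Rightarrow> bool" where
  "weighted_ricci_ge A g \<psi> N K \<longleftrightarrow>
     (\<forall>c\<in>A. \<forall>p\<in>fst c. \<forall>v.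
        weighted_ricci N (g c) (\<psi> \<circ> chart_inv c) (snd c p) v \<ge> K * metric_inner (g c) (snd c p) v v)"

text \<open>
  Eigenvalues of the operator u \<open>\<mapsto>\<close> - \<open>\<Delta>\<close>u + \<open>\<langle>\<nabla>\<close>u, \<open>\<nabla>\<psi>\<rangle>\<close>. By elliptic regularity, the eigenfunctions of its
  self-adjoint extension to the weighted L^2 space are smooth, so nothing is lost by
  considering smooth eigenfunctions only.
\<close>

definition weighted_laplacian_eigenvalue ::
    "'a topology \<Rightarrow> ('a, 'n::finite) chart set \<Rightarrow> (('a, 'n) chart \<Rightarrow> real ^ 'n \<Rightarrow> real ^ 'n ^ 'n) \<Rightarrow>
     ('a \<Rightarrow> real) \<Rightarrow> real \<Rightarrow> bool" where
  "weighted_laplacian_eigenvalue X A g \<psi> \<mu> \<longleftrightarrow>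
     (\<exists>u. smooth_fun A u \<and> (\<exists>p\<in>topspace X. u p \<noteq> 0) \<and>
        (\<forall>c\<in>A. \<forall>p\<in>fst c.
           - weighted_laplacian (g c) (\<psi> \<circ> chart_inv c) (u \<circ> chart_inv c) (snd c p) = \<mu> * u p))"

text \<open>
  The infimum is taken in the extended reals, so that a lower bound for it is exactly a lower
  bound for all nonzero eigenvalues (for a real infimum this would also need the set to be nonempty
  and bounded below).
\<close>

definition first_nonzero_eigenvalue ::
    "'a topology \<Rightarrow> ('a, 'n::finite) chart set \<Rightarrow> (('a, 'n) chart \<Rightarrow> real ^ 'n \<Rightarrow> real ^ 'n ^ 'n) \<Rightarrow>
     ('a \<Rightarrow> real) \<Rightarrow> ereal" where
  "first_nonzero_eigenvalue X A g \<psi> =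
     (INF \<mu>\<in>{\<mu>. weighted_laplacian_eigenvalue X A g \<psi> \<mu> \<and> \<mu> \<noteq> 0}. ereal \<mu>)"

end

theory Submission
  imports Defs
begin

text \<open>
  The proof uses the maximum principle instead of integration by parts. Let \<open>u\<close> be an
  eigenfunction, \<open>L u = - \<mu> u\<close> for the weighted Laplacian \<open>L\<close> and \<open>\<mu> \<noteq> 0\<close>, and suppose
  \<open>\<mu> < K N / (N - 1)\<close>.

  The weighted Bochner formula (\<open>weighted_bochner\<close>) reads
  \<open>L \<bar>\<nabla>u\<bar>\<^sup>2 / 2 = \<bar>Hess u\<bar>\<^sup>2 + \<langle>\<nabla>u, \<nabla>L u\<rangle> + (Ric + Hess \<psi>)(\<nabla>u, \<nabla>u)\<close>.
  Since \<open>\<bar>Hess u\<bar>\<^sup>2 \<ge> (\<Delta>u)\<^sup>2 / n\<close>, an elementary quadratic inequality valid for \<open>N < 0\<close> turns the curvature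
  bound into \<open>L \<bar>\<nabla>u\<bar>\<^sup>2 / 2 \<ge> (L u)\<^sup>2 / N + \<langle>\<nabla>u, \<nabla>L u\<rangle> + K \<bar>\<nabla>u\<bar>\<^sup>2\<close>
  (\<open>weighted_bochner_inequality\<close>). For an eigenfunction the terms containing \<open>u\<^sup>2\<close> cancel in
  \<open>P = \<bar>\<nabla>u\<bar>\<^sup>2 + (\<mu> / N) u\<^sup>2\<close>, which gives
  \<open>L P / 2 \<ge> (K - \<mu> (N - 1) / N) \<bar>\<nabla>u\<bar>\<^sup>2\<close> with a positive coefficient
  (\<open>eigenfunction_subharmonic\<close>).

  At a maximum of \<open>P\<close> we have \<open>L P \<le> 0\<close>, so the gradient vanishes there. Moreover \<open>\<mu>\<close> is positive
  (maximum principle for \<open>u\<^sup>2\<close>), so that \<open>\<mu> / N < 0\<close> and the maximum of \<open>P\<close> is at most \<open>0\<close>. Hence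
  \<open>\<bar>\<nabla>u\<bar>\<^sup>2 \<le> (\<mu> / \<bar>N\<bar>) u\<^sup>2\<close> everywhere (\<open>gradient_estimate\<close>): the logarithm of \<open>\<bar>u\<bar>\<close> has bounded
  gradient, and therefore the zero set of \<open>u\<close> is open (\<open>zero_near_zero\<close>). It is also closed,
  and it is nonempty because \<open>u\<close> is nonnegative at its maximum and nonpositive at its
  minimum (\<open>has_zero\<close>). As the manifold is connected, \<open>u\<close> vanishes identically, a contradiction.

  The Bochner formula is a computation in one chart. The only invariance under changes of charts that
  is needed is that of \<open>\<bar>\<nabla>u\<bar>\<^sup>2\<close>, so that \<open>P\<close> is a function on the manifold.
\<close>

section \<open>Closure properties of smooth functions\<close>

lemma Ck_on_Suc_imp: "Ck_on (Suc k) S f \<Longrightarrow> Ck_on k S f"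
proof (induction k arbitrary: f)
  case 0
  then show ?case
    by (auto simp: differentiable_imp_continuous_within intro!: continuous_at_imp_continuous_on)
next
  case (Suc k)
  then show ?case by (metis Ck_on.simps(2))
qed

lemma Ck_on_cong:
  assumes "open S" "\<And>x. x \<in> S \<Longrightarrow> f x = g x" "Ck_on k S f"
  shows "Ck_on k S g"
  using assms(2,3)
proof (induction k arbitrary: f g)
  case 0
  then show ?case by (simp cong: continuous_on_cong)
next
  case (Suc k)
  have D: "f differentiable (at x)" if "x \<in> S" for x using Suc.prems(2) that by simp
  have "g differentiable (at x)" if "x \<in> S" for x
  proof -
    have "(f has_derivative frechet_derivative f (at x)) (at x)"
      using D[OF that] by (simp add: frechet_derivative_works)
    from has_derivative_transform_within_open[OF this assms(1) that Suc.prems(1)]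
    show ?thesis unfolding differentiable_def by blast
  qed
  moreover have "Ck_on k S (\<lambda>x. frechet_derivative g (at x) v)" for v
  proof (rule Suc.IH)
    show "frechet_derivative f (at x) v = frechet_derivative g (at x) v" if "x \<in> S" for x
      using frechet_derivative_transform_within_open[OF D[OF that] assms(1) that Suc.prems(1)] by simp
    show "Ck_on k S (\<lambda>x. frechet_derivative f (at x) v)" using Suc.prems(2) by simp
  qed
  ultimately show ?case by simp
qed

text \<open>The usual way to see that a function is of class \<open>C\<^sup>k\<^sup>+\<^sup>1\<close>: exhibit a derivative whose
  directional values are of class \<open>C\<^sup>k\<close>.\<close>

lemma Ck_on_SucI:
  assumes "open S" "\<And>x. x \<in> S \<Longrightarrow> (f has_derivative f' x) (at x)"
    and "\<And>v. Ck_on k S (\<lambda>x. f' x v)"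
  shows "Ck_on (Suc k) S f"
proof -
  have "f' x v = frechet_derivative f (at x) v" if "x \<in> S" for x v
    using frechet_derivative_at[OF assms(2)[OF that]] by simp
  then have "Ck_on k S (\<lambda>x. frechet_derivative f (at x) v)" for v
    by (rule Ck_on_cong[OF assms(1) _ assms(3)])
  moreover have "f differentiable (at x)" if "x \<in> S" for x
    using assms(2)[OF that] unfolding differentiable_def by blast
  ultimately show ?thesis by simp
qed

lemma Ck_on_SucD:
  assumes "Ck_on (Suc k) S f" "x \<in> S"
  shows "(f has_derivative frechet_derivative f (at x)) (at x)"
  using assms by (simp add: frechet_derivative_works)

lemma matrix_inv_inverse:
  fixes M :: "real ^ 'n ^ 'n::finite"
  assumes "invertible M"
  shows "M ** matrix_inv M = mat 1" "matrix_inv M ** M = mat 1"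
proof -
  have "\<exists>B. M ** B = mat 1 \<and> B ** M = mat 1" using assms by (simp add: invertible_def)
  from someI_ex[OF this] show "M ** matrix_inv M = mat 1" "matrix_inv M ** M = mat 1"
    unfolding matrix_inv_def by blast+
qed

lemma Ck_on_const: "Ck_on k S (\<lambda>x. c)"
  by (induction k arbitrary: c) auto

lemma Ck_on_add:
  assumes "open S" "Ck_on k S f" "Ck_on k S g"
  shows "Ck_on k S (\<lambda>x. f x + g x)"
  using assms(2,3)
proof (induction k arbitrary: f g)
  case 0
  then show ?case by (simp add: continuous_on_add)
next
  case (Suc k)
  show ?case
  proof (rule Ck_on_SucI[OF assms(1)])
    show "((\<lambda>x. f x + g x) has_derivative
       (\<lambda>v. frechet_derivative f (at x) v + frechet_derivative g (at x) v)) (at x)" if "x \<in> S" for x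
      using Suc.prems that by (intro has_derivative_add Ck_on_SucD)
    show "Ck_on k S (\<lambda>x. frechet_derivative f (at x) v + frechet_derivative g (at x) v)" for v
      using Suc.prems by (intro Suc.IH) auto
  qed
qed

lemma Ck_on_mult:
  fixes f g :: "'a::real_normed_vector \<Rightarrow> real"
  assumes "open S" "Ck_on k S f" "Ck_on k S g"
  shows "Ck_on k S (\<lambda>x. f x * g x)"
  using assms(2,3)
proof (induction k arbitrary: f g)
  case 0
  then show ?case by (simp add: continuous_on_mult)
next
  case (Suc k)
  show ?case
  proof (rule Ck_on_SucI[OF assms(1)])
    show "((\<lambda>x. f x * g x) has_derivative
       (\<lambda>v. f x * frechet_derivative g (at x) v + frechet_derivative f (at x) v * g x)) (at x)"
      if "x \<in> S" for x
      using Suc.prems that by (intro has_derivative_mult Ck_on_SucD)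
    have "Ck_on k S f" "Ck_on k S g" using Suc.prems Ck_on_Suc_imp by blast+
    then show "Ck_on k S (\<lambda>x. f x * frechet_derivative g (at x) v + frechet_derivative f (at x) v * g x)" for v
      using Suc.prems by (intro Ck_on_add[OF assms(1)] Suc.IH) auto
  qed
qed

lemma Ck_on_inverse:
  fixes f :: "'a::real_normed_vector \<Rightarrow> real"
  assumes "open S" "Ck_on k S f" "\<And>x. x \<in> S \<Longrightarrow> f x \<noteq> 0"
  shows "Ck_on k S (\<lambda>x. inverse (f x))"
  using assms(2)
proof (induction k)
  case 0
  then show ?case using assms(3) by (simp add: continuous_on_inverse)
next
  case (Suc k)
  show ?case
  proof (rule Ck_on_SucI[OF assms(1)])
    show "((\<lambda>x. inverse (f x)) has_derivative
       (\<lambda>v. - 1 * (inverse (f x) * frechet_derivative f (at x) v * inverse (f x)))) (at x)"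
      if "x \<in> S" for x
      using Deriv.has_derivative_inverse[OF assms(3)[OF that] Ck_on_SucD[OF Suc.prems that]] by simp
    have "Ck_on k S f" using Suc.prems Ck_on_Suc_imp by blast
    then show "Ck_on k S (\<lambda>x. - 1 * (inverse (f x) * frechet_derivative f (at x) v * inverse (f x)))" for v
      using Suc.prems by (intro Ck_on_mult[OF assms(1)] Ck_on_const Suc.IH) auto
  qed
qed

lemma Ck_on_bounded_linear:
  assumes "open S" "bounded_linear L" "Ck_on k S f"
  shows "Ck_on k S (\<lambda>x. L (f x))"
  using assms(3)
proof (induction k arbitrary: f)
  case 0
  then show ?case using assms(2) by (simp add: bounded_linear.continuous_on)
next
  case (Suc k)
  show ?case
  proof (rule Ck_on_SucI[OF assms(1)])
    show "((\<lambda>x. L (f x)) has_derivative (\<lambda>v. L (frechet_derivative f (at x) v))) (at x)"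
      if "x \<in> S" for x
      using Suc.prems that by (intro bounded_linear.has_derivative[OF assms(2)] Ck_on_SucD)
    show "Ck_on k S (\<lambda>x. L (frechet_derivative f (at x) v))" for v
      using Suc.prems by (intro Suc.IH) auto
  qed
qed

lemma smooth_on_cong:
  assumes "open S" "\<And>x. x \<in> S \<Longrightarrow> f x = g x" "smooth_on S f"
  shows "smooth_on S g"
  unfolding smooth_on_def
proof
  fix k
  have "Ck_on k S f" using assms(3) by (simp only: smooth_on_def)
  then show "Ck_on k S g" using assms(1,2) by (rule Ck_on_cong[rotated 2])
qed

lemma smooth_on_const: "smooth_on S (\<lambda>x. c)"
  by (simp add: smooth_on_def Ck_on_const)

lemma smooth_on_add:
  "open S \<Longrightarrow> smooth_on S f \<Longrightarrow> smooth_on S g \<Longrightarrow> smooth_on S (\<lambda>x. f x + g x)"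
  by (simp add: smooth_on_def Ck_on_add)

lemma smooth_on_mult:
  fixes f g :: "'a::real_normed_vector \<Rightarrow> real"
  shows "open S \<Longrightarrow> smooth_on S f \<Longrightarrow> smooth_on S g \<Longrightarrow> smooth_on S (\<lambda>x. f x * g x)"
  by (simp add: smooth_on_def Ck_on_mult)

lemma smooth_on_minus:
  fixes f :: "'a::real_normed_vector \<Rightarrow> real"
  shows "open S \<Longrightarrow> smooth_on S f \<Longrightarrow> smooth_on S (\<lambda>x. - f x)"
  using smooth_on_mult[of S "\<lambda>_. -1" f] by (simp add: smooth_on_const)

lemma smooth_on_diff:
  fixes f g :: "'a::real_normed_vector \<Rightarrow> real"
  shows "open S \<Longrightarrow> smooth_on S f \<Longrightarrow> smooth_on S g \<Longrightarrow> smooth_on S (\<lambda>x. f x - g x)"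
  using smooth_on_add[of S f "\<lambda>x. - g x"] by (simp add: smooth_on_minus)

lemma smooth_on_inverse:
  fixes f :: "'a::real_normed_vector \<Rightarrow> real"
  shows "open S \<Longrightarrow> smooth_on S f \<Longrightarrow> (\<And>x. x \<in> S \<Longrightarrow> f x \<noteq> 0) \<Longrightarrow> smooth_on S (\<lambda>x. inverse (f x))"
  by (simp add: smooth_on_def Ck_on_inverse)

lemma smooth_on_sum:
  assumes "open S" "\<And>i. i \<in> I \<Longrightarrow> smooth_on S (f i)"
  shows "smooth_on S (\<lambda>x. \<Sum>i\<in>I. f i x)"
  using assms(2)
  by (induction I rule: infinite_finite_induct) (auto simp: smooth_on_const intro!: smooth_on_add assms(1))

lemma smooth_on_prod:
  fixes f :: "'i \<Rightarrow> 'a::real_normed_vector \<Rightarrow> real"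
  assumes "open S" "\<And>i. i \<in> I \<Longrightarrow> smooth_on S (f i)"
  shows "smooth_on S (\<lambda>x. \<Prod>i\<in>I. f i x)"
  using assms(2)
  by (induction I rule: infinite_finite_induct) (auto simp: smooth_on_const intro!: smooth_on_mult assms(1))

lemma smooth_on_bounded_linear:
  "open S \<Longrightarrow> bounded_linear L \<Longrightarrow> smooth_on S f \<Longrightarrow> smooth_on S (\<lambda>x. L (f x))"
  by (simp add: smooth_on_def Ck_on_bounded_linear)

lemma smooth_on_det:
  fixes M :: "'a::real_normed_vector \<Rightarrow> real ^ 'n ^ 'n::finite"
  assumes "open S" "\<And>i j. smooth_on S (\<lambda>x. M x $ i $ j)"
  shows "smooth_on S (\<lambda>x. det (M x))"
  unfolding det_def using assms
  by (intro smooth_on_sum smooth_on_mult smooth_on_prod smooth_on_const) auto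

lemma smooth_on_imp_differentiable:
  assumes "smooth_on S f" "x \<in> S" shows "f differentiable (at x)"
proof -
  have "Ck_on (Suc 0) S f" using assms(1) by (simp only: smooth_on_def)
  then show ?thesis using assms(2) by simp
qed

lemma smooth_on_imp_has_derivative:
  assumes "smooth_on S f" "x \<in> S" shows "(f has_derivative frechet_derivative f (at x)) (at x)"
  using smooth_on_imp_differentiable[OF assms] by (simp add: frechet_derivative_works)

lemma smooth_on_imp_continuous_on:
  assumes "smooth_on S f" shows "continuous_on S f"
proof -
  have "Ck_on 0 S f" using assms by (simp only: smooth_on_def)
  then show ?thesis by simp
qed

lemma smooth_on_subset:
  assumes "smooth_on S f" "T \<subseteq> S"
  shows "smooth_on T f"
proof -
  have "Ck_on k S f \<Longrightarrow> Ck_on k T f" for k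
  proof (induction k arbitrary: f)
    case 0
    then show ?case using assms(2) continuous_on_subset by auto
  next
    case (Suc k)
    then show ?case using assms(2) by auto
  qed
  then show ?thesis using assms(1) by (simp add: smooth_on_def)
qed

lemma smooth_on_directional_derivative:
  assumes "smooth_on S f" shows "smooth_on S (\<lambda>x. frechet_derivative f (at x) v)"
proof -
  have "Ck_on (Suc k) S f" for k using assms by (simp only: smooth_on_def)
  then show ?thesis by (simp add: smooth_on_def)
qed

text \<open>Cramer's rule expresses the inverse matrix through determinants, which are polynomials.\<close>

lemma smooth_on_matrix_inv:
  fixes M :: "'a::real_normed_vector \<Rightarrow> real ^ 'n ^ 'n::finite"
  assumes S: "open S" and M: "\<And>i j. smooth_on S (\<lambda>x. M x $ i $ j)"
    and inv: "\<And>x. x \<in> S \<Longrightarrow> invertible (M x)"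
  shows "smooth_on S (\<lambda>x. matrix_inv (M x) $ i $ j)"
proof -
  let ?C = "\<lambda>x. \<chi> k l. if l = i then axis j 1 $ k else M x $ k $ l"
  have nz: "det (M x) \<noteq> 0" if "x \<in> S" for x using inv[OF that] by (simp add: invertible_det_nz)
  have "smooth_on S (\<lambda>x. det (?C x) * inverse (det (M x)))"
  proof (intro smooth_on_mult[OF S] smooth_on_inverse[OF S] smooth_on_det[OF S] M nz)
    show "smooth_on S (\<lambda>x. ?C x $ k $ l)" for k l
      by (cases "l = i") (auto simp: smooth_on_const M)
  qed
  moreover have "det (?C x) * inverse (det (M x)) = matrix_inv (M x) $ i $ j" if "x \<in> S" for x
  proof -
    have "M x *v (matrix_inv (M x) *v axis j 1) = axis j 1"
      using inv[OF that] by (simp add: matrix_vector_mul_assoc matrix_inv_inverse)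
    then have "(matrix_inv (M x) *v axis j 1) $ i = det (?C x) / det (M x)"
      unfolding cramer[OF nz[OF that]] by simp
    then show ?thesis
      by (simp add: matrix_vector_mult_def axis_def if_distrib divide_inverse cong: if_cong)
  qed
  ultimately show ?thesis by (rule smooth_on_cong[OF S, rotated])
qed

section \<open>Partial derivatives\<close>

text \<open>The mean value theorem is applied along \<open>v\<close> to the difference in the direction \<open>w\<close>, and then along
  \<open>w\<close> to the derivative in the direction \<open>v\<close>.\<close>

lemma second_difference_mean_value:
  fixes f :: "'a::real_normed_vector \<Rightarrow> real"
  assumes f: "smooth_on (ball x r) f" and s: "s > 0" "s * (norm v + norm w) < r"
  shows "\<exists>y. dist x y \<le> s * (norm v + norm w) \<and>
    f (x + s *\<^sub>R v + s *\<^sub>R w) - f (x + s *\<^sub>R v) - f (x + s *\<^sub>R w) + f x =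
    s\<^sup>2 * frechet_derivative (\<lambda>z. frechet_derivative f (at z) v) (at y) w"
proof -
  let ?Dv = "\<lambda>z. frechet_derivative f (at z) v"
  have dist: "dist x (x + a *\<^sub>R v + b *\<^sub>R w) \<le> s * (norm v + norm w)"
    if "0 \<le> a" "a \<le> s" "0 \<le> b" "b \<le> s" for a b
  proof -
    have "dist x (x + a *\<^sub>R v + b *\<^sub>R w) = norm (a *\<^sub>R v + b *\<^sub>R w)"
      using norm_minus_cancel[of "a *\<^sub>R v + b *\<^sub>R w"] by (simp add: dist_norm add.commute)
    also have "\<dots> \<le> a * norm v + b * norm w"
      using norm_triangle_ineq[of "a *\<^sub>R v" "b *\<^sub>R w"] that by simp
    also have "\<dots> \<le> s * (norm v + norm w)"
      using that by (simp add: distrib_left add_mono mult_right_mono)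
    finally show ?thesis .
  qed
  then have inb: "x + a *\<^sub>R v + b *\<^sub>R w \<in> ball x r"
    if "0 \<le> a" "a \<le> s" "0 \<le> b" "b \<le> s" for a b
    using dist[OF that] s(2) by simp
  have D: "((\<lambda>a. f (x + a *\<^sub>R v + b *\<^sub>R w)) has_real_derivative ?Dv (x + a *\<^sub>R v + b *\<^sub>R w)) (at a)"
    if "0 \<le> a" "a \<le> s" "0 \<le> b" "b \<le> s" for a b
  proof -
    have fd: "(f has_derivative frechet_derivative f (at (x + a *\<^sub>R v + b *\<^sub>R w))) (at (x + a *\<^sub>R v + b *\<^sub>R w))"
      using inb[OF that] f by (rule smooth_on_imp_has_derivative[rotated])
    have "((\<lambda>a. x + a *\<^sub>R v + b *\<^sub>R w) has_derivative (\<lambda>h. h *\<^sub>R v)) (at a)"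
      by (auto intro!: derivative_eq_intros)
    from has_derivative_compose[OF this fd]
    show ?thesis
      by (simp add: has_field_derivative_def linear_cmul[OF has_derivative_linear[OF fd]] mult_commute_abs)
  qed
  let ?p = "\<lambda>a. f (x + a *\<^sub>R v + s *\<^sub>R w) - f (x + a *\<^sub>R v + 0 *\<^sub>R w)"
  have "\<exists>z>0. z < s \<and> ?p s - ?p 0 = (s - 0) * (?Dv (x + z *\<^sub>R v + s *\<^sub>R w) - ?Dv (x + z *\<^sub>R v + 0 *\<^sub>R w))"
    using s(1) by (intro MVT2 DERIV_diff D) auto
  then obtain z where z: "0 < z" "z < s"
    and e1: "?p s - ?p 0 = s * (?Dv (x + z *\<^sub>R v + s *\<^sub>R w) - ?Dv (x + z *\<^sub>R v + 0 *\<^sub>R w))" by auto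
  have D2: "((\<lambda>b. ?Dv (x + z *\<^sub>R v + b *\<^sub>R w)) has_real_derivative
      frechet_derivative ?Dv (at (x + z *\<^sub>R v + b *\<^sub>R w)) w) (at b)" if "0 \<le> b" "b \<le> s" for b
  proof -
    have fd: "(?Dv has_derivative frechet_derivative ?Dv (at (x + z *\<^sub>R v + b *\<^sub>R w))) (at (x + z *\<^sub>R v + b *\<^sub>R w))"
      using inb[of z b] z that
      by (intro smooth_on_imp_has_derivative[OF smooth_on_directional_derivative[OF f]]) auto
    have "((\<lambda>b. x + z *\<^sub>R v + b *\<^sub>R w) has_derivative (\<lambda>h. h *\<^sub>R w)) (at b)"
      by (auto intro!: derivative_eq_intros)
    from has_derivative_compose[OF this fd]
    show ?thesis
      by (simp add: has_field_derivative_def linear_cmul[OF has_derivative_linear[OF fd]] mult_commute_abs)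
  qed
  have "\<exists>t>0. t < s \<and> ?Dv (x + z *\<^sub>R v + s *\<^sub>R w) - ?Dv (x + z *\<^sub>R v + 0 *\<^sub>R w) =
      (s - 0) * frechet_derivative ?Dv (at (x + z *\<^sub>R v + t *\<^sub>R w)) w"
    using s(1) by (intro MVT2 D2) auto
  then obtain t where t: "0 < t" "t < s"
    and e2: "?Dv (x + z *\<^sub>R v + s *\<^sub>R w) - ?Dv (x + z *\<^sub>R v + 0 *\<^sub>R w) =
      s * frechet_derivative ?Dv (at (x + z *\<^sub>R v + t *\<^sub>R w)) w" by auto
  show ?thesis
    using dist[of z t] z t e1 unfolding e2
    by (intro exI[of _ "x + z *\<^sub>R v + t *\<^sub>R w"]) (simp add: power2_eq_square)
qed

text \<open>The second difference is symmetric in \<open>v\<close> and \<open>w\<close>, so after division by \<open>s\<^sup>2\<close> it is a value near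
  \<open>x\<close> of the mixed derivative in either order. Both are continuous, and \<open>s\<close> is arbitrarily small.\<close>

lemma mixed_derivatives_commute:
  fixes f :: "'a::real_normed_vector \<Rightarrow> real"
  assumes "open S" "x \<in> S" "smooth_on S f"
  shows "frechet_derivative (\<lambda>z. frechet_derivative f (at z) v) (at x) w =
         frechet_derivative (\<lambda>z. frechet_derivative f (at z) w) (at x) v"
proof -
  let ?A = "\<lambda>y. frechet_derivative (\<lambda>z. frechet_derivative f (at z) v) (at y) w"
  let ?B = "\<lambda>y. frechet_derivative (\<lambda>z. frechet_derivative f (at z) w) (at y) v"
  have sm: "smooth_on S ?A" "smooth_on S ?B"
    by (intro smooth_on_directional_derivative assms)+
  have cA: "isCont ?A x" and cB: "isCont ?B x"
    using sm[THEN smooth_on_imp_continuous_on] assms(2) by (simp_all add: continuous_on_eq_continuous_at[OF assms(1)])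
  have near: "\<bar>?A x - ?B x\<bar> < e" if e: "e > 0" for e
  proof -
    obtain r where r: "r > 0" "ball x r \<subseteq> S" using assms(1,2) openE by blast
    have f: "smooth_on (ball x r) f"
      using smooth_on_subset[OF assms(3) r(2)] .
    obtain d1 where d1: "d1 > 0" "\<And>y. dist y x < d1 \<Longrightarrow> dist (?A y) (?A x) < e / 2"
      using cA[unfolded continuous_at_eps_delta, rule_format, of "e / 2"] e by auto
    obtain d2 where d2: "d2 > 0" "\<And>y. dist y x < d2 \<Longrightarrow> dist (?B y) (?B x) < e / 2"
      using cB[unfolded continuous_at_eps_delta, rule_format, of "e / 2"] e by auto
    define d where "d = min r (min d1 d2)"
    have d: "d > 0" "d \<le> r" "d \<le> d1" "d \<le> d2" using r(1) d1(1) d2(1) by (auto simp: d_def)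
    define s where "s = d / 2 / (norm v + norm w + 1)"
    have pos: "norm v + norm w + 1 > 0" by (smt (verit) norm_ge_zero)
    have s: "s > 0" using d(1) pos by (simp add: s_def)
    have "s * (norm v + norm w) \<le> s * (norm v + norm w + 1)" using s by simp
    also have "\<dots> = d / 2" unfolding s_def by (rule nonzero_eq_divide_eq[THEN iffD1]) (use pos in simp_all)
    finally have sd: "s * (norm v + norm w) < d" using d(1) by linarith
    obtain y where y: "dist x y \<le> s * (norm v + norm w)"
      "f (x + s *\<^sub>R v + s *\<^sub>R w) - f (x + s *\<^sub>R v) - f (x + s *\<^sub>R w) + f x = s\<^sup>2 * ?A y"
      using second_difference_mean_value[OF f s, of v w] sd d(2) by auto
    obtain y' where y': "dist x y' \<le> s * (norm w + norm v)"
      "f (x + s *\<^sub>R w + s *\<^sub>R v) - f (x + s *\<^sub>R w) - f (x + s *\<^sub>R v) + f x = s\<^sup>2 * ?B y'"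
      using second_difference_mean_value[OF f s, of w v] sd d(2) by (auto simp: add.commute[of "norm w"])
    have "s\<^sup>2 * ?A y = s\<^sup>2 * ?B y'"
      using y(2) y'(2) by (simp add: algebra_simps)
    then have AB: "?A y = ?B y'" using s by simp
    have "dist y x < d1" "dist y' x < d2"
      using y(1) y'(1) sd d(3,4) by (simp_all add: dist_commute[of _ x] add.commute[of "norm w"])
    then have "\<bar>?A y - ?A x\<bar> < e/2" "\<bar>?B y' - ?B x\<bar> < e/2"
      using d1(2) d2(2) by (auto simp: dist_real_def)
    then show ?thesis using AB by linarith
  qed
  show ?thesis
  proof (rule ccontr)
    assume "?A x \<noteq> ?B x"
    then show False using near[of "\<bar>?A x - ?B x\<bar>"] by simp
  qed
qed

lemma smooth_on_pderiv_at: "smooth_on S f \<Longrightarrow> smooth_on S (pderiv_at i f)"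
  using smooth_on_directional_derivative[of S f "axis i 1"] by (simp add: pderiv_at_def[abs_def])

lemma pderiv_at_commute:
  assumes "open S" "x \<in> S" "smooth_on S f"
  shows "pderiv_at i (pderiv_at j f) x = pderiv_at j (pderiv_at i f) x"
  using mixed_derivatives_commute[OF assms] by (simp add: pderiv_at_def[abs_def])

lemma pderiv_at_cong:
  assumes "open S" "x \<in> S" "smooth_on S f" "\<And>y. y \<in> S \<Longrightarrow> f y = g y"
  shows "pderiv_at i f x = pderiv_at i g x"
  using frechet_derivative_transform_within_open[OF smooth_on_imp_differentiable[OF assms(3,2)] assms(1,2,4)]
  by (simp add: pderiv_at_def)

lemma pderiv_at_eqI: "(f has_derivative f') (at x) \<Longrightarrow> pderiv_at i f x = f' (axis i 1)"
  by (metis frechet_derivative_at pderiv_at_def)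

lemma pderiv_at_const: "pderiv_at i (\<lambda>y. c) x = 0"
  by (simp add: pderiv_at_def)

lemma pderiv_at_add:
  assumes "smooth_on S f" "smooth_on S g" "x \<in> S"
  shows "pderiv_at i (\<lambda>y. f y + g y) x = pderiv_at i f x + pderiv_at i g x"
  using has_derivative_add[OF smooth_on_imp_has_derivative[OF assms(1,3)] smooth_on_imp_has_derivative[OF assms(2,3)]]
  by (rule pderiv_at_eqI[THEN trans]) (simp add: pderiv_at_def)

lemma pderiv_at_mult:
  assumes "smooth_on S f" "smooth_on S g" "x \<in> S"
  shows "pderiv_at i (\<lambda>y. f y * g y) x = pderiv_at i f x * g x + f x * pderiv_at i g x"
  using has_derivative_mult[OF smooth_on_imp_has_derivative[OF assms(1,3)] smooth_on_imp_has_derivative[OF assms(2,3)]]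
  by (rule pderiv_at_eqI[THEN trans]) (simp add: pderiv_at_def)

lemma pderiv_at_minus:
  assumes "smooth_on S f" "x \<in> S"
  shows "pderiv_at i (\<lambda>y. - f y) x = - pderiv_at i f x"
  using has_derivative_minus[OF smooth_on_imp_has_derivative[OF assms]]
  by (rule pderiv_at_eqI[THEN trans]) (simp add: pderiv_at_def)

lemma pderiv_at_diff:
  assumes "smooth_on S f" "smooth_on S g" "x \<in> S"
  shows "pderiv_at i (\<lambda>y. f y - g y) x = pderiv_at i f x - pderiv_at i g x"
  using has_derivative_diff[OF smooth_on_imp_has_derivative[OF assms(1,3)] smooth_on_imp_has_derivative[OF assms(2,3)]]
  by (rule pderiv_at_eqI[THEN trans]) (simp add: pderiv_at_def)

lemma pderiv_at_sum:
  assumes "\<And>a. a \<in> I \<Longrightarrow> smooth_on S (f a)" "x \<in> S"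
  shows "pderiv_at i (\<lambda>y. \<Sum>a\<in>I. f a y) x = (\<Sum>a\<in>I. pderiv_at i (f a) x)"
  using has_derivative_sum[of I f "\<lambda>a. frechet_derivative (f a) (at x)" "at x"]
    smooth_on_imp_has_derivative[OF assms(1) assms(2)]
  by (intro pderiv_at_eqI[THEN trans]) (auto simp: pderiv_at_def)

section \<open>The metric in a chart\<close>

lemma matrix_mul_minus_left: "(- A) ** B = - (A ** B)" for A :: "real ^ 'n ^ 'm" and B :: "real ^ 'k ^ 'n"
  by (simp add: vec_eq_iff matrix_matrix_mult_def sum_negf)

lemma matrix_mul_minus_right: "A ** (- B) = - (A ** B)" for A :: "real ^ 'n ^ 'm" and B :: "real ^ 'k ^ 'n"
  by (simp add: vec_eq_iff matrix_matrix_mult_def sum_negf)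

lemma matrix_add_rdistrib: "(A + B) ** C = A ** C + B ** C" for A B :: "real ^ 'n ^ 'm" and C :: "real ^ 'k ^ 'n"
  by (simp add: vec_eq_iff matrix_matrix_mult_def distrib_right sum.distrib)

lemma transpose_add: "transpose (A + B) = transpose A + transpose B" for A B :: "real ^ 'n ^ 'm"
  by (simp add: vec_eq_iff transpose_def)

lemma transpose_minus: "transpose (- A) = - transpose A" for A :: "real ^ 'n ^ 'm"
  by (simp add: vec_eq_iff transpose_def)

locale local_metric =
  fixes S :: "(real ^ 'n::finite) set" and G :: "real ^ 'n \<Rightarrow> real ^ 'n ^ 'n"
  assumes open_S: "open S" and smooth_G: "smooth_on S G"
    and sym_G: "x \<in> S \<Longrightarrow> transpose (G x) = G x"
    and pos_G: "x \<in> S \<Longrightarrow> v \<noteq> 0 \<Longrightarrow> 0 < v \<bullet> (G x *v v)"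
begin

abbreviation "ginv \<equiv> inverse_metric G"
abbreviation "\<Gamma> \<equiv> christoffel G"
abbreviation "H \<equiv> hessian_comp G"

lemma smooth_G_comp: "smooth_on S (\<lambda>x. G x $ i $ j)"
  using smooth_on_bounded_linear[OF open_S bounded_linear_vec_nth[of j]
      smooth_on_bounded_linear[OF open_S bounded_linear_vec_nth[of i] smooth_G]] .

lemma invertible_G: assumes "x \<in> S" shows "invertible (G x)"
proof -
  have "v = 0" if "G x *v v = 0" for v
    using pos_G[OF assms, of v] that by fastforce
  then show ?thesis
    by (simp add: invertible_left_inverse matrix_left_invertible_ker)
qed

lemma G_ginv:
  assumes "x \<in> S"
  shows "G x ** matrix_inv (G x) = mat 1" "matrix_inv (G x) ** G x = mat 1"
  using matrix_inv_inverse[OF invertible_G[OF assms]] by auto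

lemma transpose_ginv: assumes "x \<in> S" shows "transpose (matrix_inv (G x)) = matrix_inv (G x)"
proof -
  have "transpose (matrix_inv (G x)) ** G x = mat 1"
    using arg_cong[OF G_ginv(1)[OF assms], of transpose] sym_G[OF assms]
    by (simp add: matrix_transpose_mul transpose_mat)
  then show ?thesis using G_ginv[OF assms]
    by (metis matrix_mul_assoc matrix_mul_lid matrix_mul_rid)
qed

lemma G_sym: "x \<in> S \<Longrightarrow> G x $ i $ j = G x $ j $ i"
  using arg_cong[OF sym_G[of x], of "\<lambda>M. M $ j $ i"] by (simp add: transpose_def)

lemma ginv_sym: "x \<in> S \<Longrightarrow> ginv i j x = ginv j i x"
  using arg_cong[OF transpose_ginv[of x], of "\<lambda>M. M $ j $ i"]
  by (simp add: transpose_def inverse_metric_def)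

lemma G_ginv_sum:
  assumes "x \<in> S"
  shows "(\<Sum>m\<in>UNIV. G x $ i $ m * ginv m j x) = (if i = j then 1 else 0)"
  using arg_cong[OF G_ginv(1)[OF assms], of "\<lambda>M. M $ i $ j"]
  by (simp add: matrix_matrix_mult_def inverse_metric_def mat_def)

lemma ginv_G_sum:
  assumes "x \<in> S"
  shows "(\<Sum>m\<in>UNIV. ginv i m x * G x $ m $ j) = (if i = j then 1 else 0)"
  using arg_cong[OF G_ginv(2)[OF assms], of "\<lambda>M. M $ i $ j"]
  by (simp add: matrix_matrix_mult_def inverse_metric_def mat_def)

lemma smooth_ginv: "smooth_on S (ginv i j)"
  using smooth_on_matrix_inv[OF open_S smooth_G_comp invertible_G]
  by (simp add: inverse_metric_def[abs_def])

lemmas smooth_intros = smooth_on_add[OF open_S] smooth_on_mult[OF open_S] smooth_on_minus[OF open_S]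
  smooth_on_diff[OF open_S] smooth_on_sum[OF open_S] smooth_on_const smooth_on_pderiv_at
  smooth_G_comp smooth_ginv

lemma smooth_christoffel: "smooth_on S (\<Gamma> k i j)"
  unfolding christoffel_def[abs_def] by (intro smooth_intros)

lemma smooth_hessian: "smooth_on S f \<Longrightarrow> smooth_on S (H f i j)"
  unfolding hessian_comp_def[abs_def] by (intro smooth_intros smooth_christoffel)

lemma smooth_gradient: "smooth_on S f \<Longrightarrow> smooth_on S (\<lambda>x. gradient G f x $ k)"
  unfolding gradient_def by (simp, intro smooth_intros)

lemma christoffel_sym: "x \<in> S \<Longrightarrow> \<Gamma> k i j x = \<Gamma> k j i x"
proof -
  assume x: "x \<in> S"
  have "pderiv_at l (\<lambda>y. G y $ i $ j) x = pderiv_at l (\<lambda>y. G y $ j $ i) x" for l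
    by (rule pderiv_at_cong[OF open_S x smooth_G_comp]) (rule G_sym)
  then show ?thesis by (simp add: christoffel_def algebra_simps)
qed

lemma hessian_sym: "x \<in> S \<Longrightarrow> smooth_on S f \<Longrightarrow> H f i j x = H f j i x"
  using pderiv_at_commute[OF open_S, of x f i j] christoffel_sym[of x _ i j]
  by (simp add: hessian_comp_def)

subsection \<open>Parallelism of the metric\<close>

lemma christoffel_lowered:
  assumes x: "x \<in> S"
  shows "(\<Sum>m\<in>UNIV. G x $ j $ m * \<Gamma> m k i x) = 1/2 * (pderiv_at k (\<lambda>y. G y $ i $ j) x
    + pderiv_at i (\<lambda>y. G y $ k $ j) x - pderiv_at j (\<lambda>y. G y $ k $ i) x)"
proof -
  let ?E = "\<lambda>l. pderiv_at k (\<lambda>y. G y $ i $ l) x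
    + pderiv_at i (\<lambda>y. G y $ k $ l) x - pderiv_at l (\<lambda>y. G y $ k $ i) x"
  have "(\<Sum>m\<in>UNIV. G x $ j $ m * \<Gamma> m k i x) = (\<Sum>m\<in>UNIV. \<Sum>l\<in>UNIV. 1/2 * (G x $ j $ m * ginv m l x * ?E l))"
    by (simp add: christoffel_def sum_distrib_left mult.assoc mult.left_commute[of _ "1/2"])
  also have "\<dots> = (\<Sum>l\<in>UNIV. 1/2 * ((\<Sum>m\<in>UNIV. G x $ j $ m * ginv m l x) * ?E l))"
    by (subst sum.swap) (simp add: sum_distrib_left sum_distrib_right)
  also have "\<dots> = 1/2 * ?E j"
    by (simp add: G_ginv_sum[OF x] if_distrib[of "\<lambda>a. a * _"]
        sum_divide_distrib[symmetric] cong: if_cong)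
  finally show ?thesis .
qed

text \<open>Symmetrizing the lowered symbols in their first and third index cancels all but one of the
  derivatives of the metric: the Levi-Civita connection is metric.\<close>

lemma pderiv_metric:
  assumes x: "x \<in> S"
  shows "pderiv_at k (\<lambda>y. G y $ i $ j) x =
    (\<Sum>m\<in>UNIV. \<Gamma> m k i x * G x $ m $ j) + (\<Sum>m\<in>UNIV. G x $ i $ m * \<Gamma> m k j x)"
proof -
  have s: "pderiv_at l (\<lambda>y. G y $ i $ j) x = pderiv_at l (\<lambda>y. G y $ j $ i) x" for l i j
    by (rule pderiv_at_cong[OF open_S x smooth_G_comp]) (rule G_sym)
  have "(\<Sum>m\<in>UNIV. \<Gamma> m k i x * G x $ m $ j) = (\<Sum>m\<in>UNIV. G x $ j $ m * \<Gamma> m k i x)"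
    by (simp add: G_sym[OF x, of _ j] mult.commute)
  then show ?thesis
    using s[of k i j] s[of i k j] s[of j k i] christoffel_lowered[OF x, of j k i]
      christoffel_lowered[OF x, of i k j] by (simp add: field_simps)
qed

text \<open>With the indices \<open>i, j\<close> of the symbols collected in matrices, the identities for the inverse metric
  become computations in a matrix ring.\<close>

definition conn :: "'n \<Rightarrow> real ^ 'n \<Rightarrow> real ^ 'n ^ 'n" where
  "conn k x = (\<chi> i j. \<Gamma> i k j x)"

text \<open>Differentiate the product of the inverse metric and the metric, which is constant, and insert
  the derivative of the metric.\<close>

lemma pderiv_ginv_matrix:
  assumes x: "x \<in> S"
  shows "(\<chi> i j. pderiv_at k (ginv i j) x) =
    - (conn k x ** matrix_inv (G x) + matrix_inv (G x) ** transpose (conn k x))"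
proof -
  let ?D = "\<chi> i j. pderiv_at k (ginv i j) x" and ?E = "\<chi> i j. pderiv_at k (\<lambda>y. G y $ i $ j) x"
  let ?h = "matrix_inv (G x)"
  have E: "?E = transpose (conn k x) ** G x + G x ** conn k x"
    by (simp add: vec_eq_iff matrix_matrix_mult_def conn_def transpose_def pderiv_metric[OF x])
  have "?D ** G x + ?h ** ?E = 0"
  proof -
    have "(\<Sum>m\<in>UNIV. pderiv_at k (ginv i m) x * G x $ m $ j) + (\<Sum>m\<in>UNIV. ginv i m x * pderiv_at k (\<lambda>y. G y $ m $ j) x) = 0" for i j
    proof -
      have "pderiv_at k (\<lambda>y. \<Sum>m\<in>UNIV. ginv i m y * G y $ m $ j) x = pderiv_at k (\<lambda>y. if i = j then 1 else 0) x"
        by (rule pderiv_at_cong[OF open_S x]) (intro smooth_intros, rule ginv_G_sum)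
      then show ?thesis
        by (simp add: pderiv_at_const pderiv_at_sum[of _ S, OF _ x] smooth_intros
            pderiv_at_mult[OF smooth_ginv smooth_G_comp x] sum.distrib)
    qed
    then show ?thesis by (simp add: vec_eq_iff matrix_matrix_mult_def inverse_metric_def)
  qed
  then have "?D ** G x = - (?h ** ?E)" by (simp add: eq_neg_iff_add_eq_0)
  then have "?D ** G x ** ?h = - (?h ** ?E ** ?h)"
    by (simp only: matrix_mul_minus_left)
  then have "?D = - (?h ** ?E ** ?h)"
    by (simp add: matrix_mul_assoc[symmetric] G_ginv[OF x])
  also have "?h ** ?E ** ?h = ?h ** transpose (conn k x) ** (G x ** ?h) + (?h ** G x) ** conn k x ** ?h"
    by (simp add: E matrix_add_ldistrib matrix_add_rdistrib matrix_mul_assoc)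
  finally show ?thesis by (simp add: G_ginv[OF x] add.commute)
qed

lemma pderiv_ginv:
  assumes x: "x \<in> S"
  shows "pderiv_at k (ginv i j) x =
    - (\<Sum>m\<in>UNIV. \<Gamma> i k m x * ginv m j x) - (\<Sum>m\<in>UNIV. \<Gamma> j k m x * ginv i m x)"
  using arg_cong[OF pderiv_ginv_matrix[OF x, of k], of "\<lambda>M. M $ i $ j"]
  by (simp add: matrix_matrix_mult_def conn_def transpose_def inverse_metric_def mult.commute)

subsection \<open>Curvature\<close>

definition curv :: "'n \<Rightarrow> 'n \<Rightarrow> real ^ 'n \<Rightarrow> real ^ 'n ^ 'n" where
  "curv l i x = (\<chi> m k. riemann_curv G m l i k x)"

lemma curv_eq:
  "curv l i x = (\<chi> m k. pderiv_at l (\<Gamma> m i k) x) - (\<chi> m k. pderiv_at i (\<Gamma> m l k) x)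
    + conn l x ** conn i x - conn i x ** conn l x"
  by (simp add: vec_eq_iff curv_def riemann_curv_def conn_def matrix_matrix_mult_def
      sum_subtractf mult.commute)

text \<open>The curvature operator of a coordinate plane is skew-adjoint because the second partial
  derivatives of the inverse metric commute; the formula for its first derivatives is inserted twice.\<close>

lemma curv_skew_matrix:
  assumes x: "x \<in> S"
  shows "curv l i x ** matrix_inv (G x) + matrix_inv (G x) ** transpose (curv l i x) = 0"
proof -
  let ?h = "matrix_inv (G x)"
  define B where "B l i = (\<chi> m k. pderiv_at l (\<Gamma> m i k) x)" for l i
  define A where "A i = conn i x" for i
  define D where "D l i = (\<chi> m p. pderiv_at l (pderiv_at i (ginv m p)) x)" for l i
  have D_sym: "D l i = D i l"
    by (simp add: D_def vec_eq_iff pderiv_at_commute[OF open_S x smooth_ginv, of l i])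
  have D_eq: "D l i = - (B l i ** ?h + ?h ** transpose (B l i))
      + (A i ** (A l ** ?h + ?h ** transpose (A l)) + (A l ** ?h + ?h ** transpose (A l)) ** transpose (A i))" for l i
  proof -
    have "pderiv_at l (pderiv_at i (ginv m p)) x =
      pderiv_at l (\<lambda>y. - (\<Sum>q\<in>UNIV. \<Gamma> m i q y * ginv q p y) - (\<Sum>q\<in>UNIV. \<Gamma> p i q y * ginv m q y)) x" for m p
      by (rule pderiv_at_cong[OF open_S x]) (intro smooth_intros, rule pderiv_ginv)
    then have e: "D l i $ m $ p =
        - (\<Sum>q\<in>UNIV. pderiv_at l (\<Gamma> m i q) x * ginv q p x + \<Gamma> m i q x * pderiv_at l (ginv q p) x)
        - (\<Sum>q\<in>UNIV. pderiv_at l (\<Gamma> p i q) x * ginv m q x + \<Gamma> p i q x * pderiv_at l (ginv m q) x)" for m p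
      by (simp add: D_def pderiv_at_diff[of S, OF _ _ x] pderiv_at_minus[of S, OF _ x]
          pderiv_at_sum[of _ S, OF _ x] pderiv_at_mult[OF _ _ x] smooth_intros smooth_christoffel)
    have "D l i = - (B l i ** ?h + ?h ** transpose (B l i))
      - (A i ** (\<chi> i j. pderiv_at l (ginv i j) x) + (\<chi> i j. pderiv_at l (ginv i j) x) ** transpose (A i))"
      by (simp add: vec_eq_iff e B_def A_def conn_def matrix_matrix_mult_def transpose_def
          inverse_metric_def sum.distrib mult.commute)
    then show ?thesis
      by (simp only: pderiv_ginv_matrix[OF x] matrix_mul_minus_left matrix_mul_minus_right A_def) simp
  qed
  have "curv l i x = B l i - B i l + A l ** A i - A i ** A l"
    by (simp add: curv_eq B_def A_def)
  then have c: "curv l i x = B l i + - B i l + A l ** A i + - (A i ** A l)" by simp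
  have "curv l i x ** ?h + ?h ** transpose (curv l i x) = D i l - D l i"
    unfolding c D_eq
    by (simp only: matrix_add_ldistrib matrix_add_rdistrib matrix_mul_minus_left matrix_mul_minus_right
        transpose_add transpose_minus matrix_transpose_mul matrix_mul_assoc) simp
  then show ?thesis using D_sym by simp
qed

text \<open>This is the term that appears when the order of derivatives is exchanged in the Laplacian of a
  gradient. The Ricci curvature is a trace over the first two indices, and skew-adjointness turns the
  trace here into that one, at the price of a sign.\<close>

lemma curv_contraction:
  assumes x: "x \<in> S"
  shows "(\<Sum>l\<in>UNIV. \<Sum>i\<in>UNIV. ginv l i x * (\<Sum>m\<in>UNIV. riemann_curv G m l k i x * p m)) =
    - (\<Sum>j\<in>UNIV. (\<Sum>l\<in>UNIV. riemann_curv G l l k j x) * (\<Sum>m\<in>UNIV. ginv j m x * p m))"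
proof -
  have skew: "(\<Sum>i\<in>UNIV. riemann_curv G m l k i x * ginv i s x) =
    - (\<Sum>q\<in>UNIV. riemann_curv G s l k q x * ginv q m x)" for m l s
    using arg_cong[OF curv_skew_matrix[OF x, of l k], of "\<lambda>M. M $ m $ s"]
    by (simp add: matrix_matrix_mult_def curv_def transpose_def inverse_metric_def[symmetric]
        ginv_sym[OF x, of m] mult.commute eq_neg_iff_add_eq_0)
  have trace: "(\<Sum>i\<in>UNIV. riemann_curv G m l k i x * ginv i l x) =
    - (\<Sum>q\<in>UNIV. riemann_curv G l l k q x * ginv q m x)" for m l
    by (rule skew)
  have "(\<Sum>l\<in>UNIV. \<Sum>i\<in>UNIV. ginv l i x * (\<Sum>m\<in>UNIV. riemann_curv G m l k i x * p m)) =
    (\<Sum>l\<in>UNIV. \<Sum>i\<in>UNIV. \<Sum>m\<in>UNIV. riemann_curv G m l k i x * ginv i l x * p m)"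
    by (simp add: sum_distrib_left ginv_sym[OF x] mult_ac)
  also have "\<dots> = (\<Sum>l\<in>UNIV. \<Sum>m\<in>UNIV. (\<Sum>i\<in>UNIV. riemann_curv G m l k i x * ginv i l x) * p m)"
    by (rule sum.cong[OF refl], subst sum.swap) (simp add: sum_distrib_right)
  also have "\<dots> = - (\<Sum>l\<in>UNIV. \<Sum>m\<in>UNIV. \<Sum>q\<in>UNIV. riemann_curv G l l k q x * (ginv q m x * p m))"
    by (simp only: trace) (simp add: sum_distrib_right sum_negf mult.assoc)
  also have "(\<Sum>l\<in>UNIV. \<Sum>m\<in>UNIV. \<Sum>q\<in>UNIV. riemann_curv G l l k q x * (ginv q m x * p m)) =
     (\<Sum>l\<in>UNIV. \<Sum>q\<in>UNIV. riemann_curv G l l k q x * (\<Sum>m\<in>UNIV. ginv q m x * p m))"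
    by (rule sum.cong[OF refl], subst sum.swap) (simp add: sum_distrib_left)
  also have "\<dots> = (\<Sum>j\<in>UNIV. (\<Sum>l\<in>UNIV. riemann_curv G l l k j x) * (\<Sum>m\<in>UNIV. ginv j m x * p m))"
    by (subst sum.swap) (simp add: sum_distrib_right)
  finally show ?thesis .
qed

end

section \<open>The Bochner formula\<close>

lemma sum_rotate:
  "(\<Sum>l\<in>A. \<Sum>i\<in>B. \<Sum>k\<in>C. F l i k) = (\<Sum>k\<in>C. \<Sum>l\<in>A. \<Sum>i\<in>B. F l i k)"
proof -
  have "(\<Sum>l\<in>A. \<Sum>i\<in>B. \<Sum>k\<in>C. F l i k) = (\<Sum>l\<in>A. \<Sum>k\<in>C. \<Sum>i\<in>B. F l i k)"
    by (rule sum.cong[OF refl], rule sum.swap)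
  also have "\<dots> = (\<Sum>k\<in>C. \<Sum>l\<in>A. \<Sum>i\<in>B. F l i k)" by (rule sum.swap)
  finally show ?thesis .
qed

context local_metric
begin

abbreviation grad where "grad f k x \<equiv> gradient G f x $ k"

definition dot_grad :: "(real ^ 'n \<Rightarrow> real) \<Rightarrow> (real ^ 'n \<Rightarrow> real) \<Rightarrow> real ^ 'n \<Rightarrow> real" where
  "dot_grad f f' x = (\<Sum>k\<in>UNIV. pderiv_at k f x * grad f' k x)"

lemma metric_gradient: assumes "x \<in> S" shows "G x *v gradient G f x = (\<chi> k. pderiv_at k f x)"
proof -
  have "gradient G f x = matrix_inv (G x) *v (\<chi> k. pderiv_at k f x)"
    by (simp add: vec_eq_iff gradient_def matrix_vector_mult_def inverse_metric_def)
  then show ?thesis by (simp add: matrix_vector_mul_assoc G_ginv[OF assms])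
qed

lemma metric_inner_gradient:
  "x \<in> S \<Longrightarrow> metric_inner G x v (gradient G f x) = (\<Sum>k\<in>UNIV. pderiv_at k f x * v $ k)"
  by (simp add: metric_inner_def metric_gradient inner_vec_def mult.commute)

lemma dot_grad_sym: "x \<in> S \<Longrightarrow> dot_grad f f' x = dot_grad f' f x"
  unfolding dot_grad_def gradient_def
  by (simp add: sum_distrib_left, subst sum.swap) (simp add: ginv_sym mult_ac)

lemma metric_inner_gradients:
  "x \<in> S \<Longrightarrow> metric_inner G x (gradient G f x) (gradient G f' x) = dot_grad f f' x"
  using dot_grad_sym[of x f f'] by (simp add: metric_inner_gradient dot_grad_def)

lemma smooth_dot_grad: "smooth_on S f \<Longrightarrow> smooth_on S f' \<Longrightarrow> smooth_on S (dot_grad f f')"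
  unfolding dot_grad_def[abs_def] by (intro smooth_intros smooth_gradient)

lemma smooth_laplacian: "smooth_on S f \<Longrightarrow> smooth_on S (laplacian G f)"
  unfolding laplacian_def[abs_def] by (intro smooth_intros smooth_hessian)

lemma second_pderiv_eq: "pderiv_at i (pderiv_at j f) x = H f i j x + (\<Sum>m\<in>UNIV. \<Gamma> m i j x * pderiv_at m f x)"
  by (simp add: hessian_comp_def)

text \<open>The covariant derivative of the gradient is the Hessian with an index raised: the symbols coming from
  the second partial derivatives cancel one of the two terms in the derivative of the inverse metric.\<close>

lemma pderiv_gradient:
  assumes x: "x \<in> S" and f: "smooth_on S f"
  shows "pderiv_at i (\<lambda>y. grad f k y) x =
    (\<Sum>j\<in>UNIV. ginv k j x * H f i j x) - (\<Sum>m\<in>UNIV. \<Gamma> k i m x * grad f m x)"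
proof -
  have "pderiv_at i (\<lambda>y. grad f k y) x =
    (\<Sum>j\<in>UNIV. pderiv_at i (ginv k j) x * pderiv_at j f x + ginv k j x * pderiv_at i (pderiv_at j f) x)"
    unfolding gradient_def using f
    by (simp add: pderiv_at_sum[of _ S, OF _ x] pderiv_at_mult[OF _ _ x] smooth_intros)
  also have "\<dots> = (\<Sum>j\<in>UNIV. ginv k j x * H f i j x)
      - (\<Sum>j\<in>UNIV. \<Sum>m\<in>UNIV. \<Gamma> k i m x * (ginv m j x * pderiv_at j f x))
      - (\<Sum>j\<in>UNIV. \<Sum>m\<in>UNIV. ginv k m x * \<Gamma> j i m x * pderiv_at j f x)
      + (\<Sum>j\<in>UNIV. \<Sum>m\<in>UNIV. ginv k j x * \<Gamma> m i j x * pderiv_at m f x)"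
    by (simp add: pderiv_ginv[OF x] second_pderiv_eq algebra_simps sum.distrib
        sum_subtractf sum_negf sum_distrib_left sum_distrib_right)
  also have "(\<Sum>j\<in>UNIV. \<Sum>m\<in>UNIV. ginv k m x * \<Gamma> j i m x * pderiv_at j f x) =
    (\<Sum>j\<in>UNIV. \<Sum>m\<in>UNIV. ginv k j x * \<Gamma> m i j x * pderiv_at m f x)"
    by (rule sum.swap)
  also have "(\<Sum>j\<in>UNIV. \<Sum>m\<in>UNIV. \<Gamma> k i m x * (ginv m j x * pderiv_at j f x)) =
    (\<Sum>m\<in>UNIV. \<Gamma> k i m x * grad f m x)"
    by (subst sum.swap) (simp add: gradient_def sum_distrib_left)
  finally show ?thesis by simp
qed

lemma pderiv_dot_grad:
  assumes x: "x \<in> S" and f: "smooth_on S f" and f': "smooth_on S f'"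
  shows "pderiv_at i (dot_grad f f') x =
    (\<Sum>k\<in>UNIV. H f i k x * grad f' k x) + (\<Sum>k\<in>UNIV. H f' i k x * grad f k x)"
proof -
  have "pderiv_at i (dot_grad f f') x =
    (\<Sum>k\<in>UNIV. pderiv_at i (pderiv_at k f) x * grad f' k x + pderiv_at k f x * pderiv_at i (\<lambda>y. grad f' k y) x)"
    unfolding dot_grad_def[abs_def] using f f'
    by (simp add: pderiv_at_sum[of _ S, OF _ x] pderiv_at_mult[OF _ _ x] smooth_intros smooth_gradient)
  also have "\<dots> = (\<Sum>k\<in>UNIV. H f i k x * grad f' k x)
      + (\<Sum>k\<in>UNIV. \<Sum>m\<in>UNIV. \<Gamma> m i k x * pderiv_at m f x * grad f' k x)
      + (\<Sum>k\<in>UNIV. \<Sum>j\<in>UNIV. H f' i j x * (ginv j k x * pderiv_at k f x))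
      - (\<Sum>k\<in>UNIV. \<Sum>m\<in>UNIV. \<Gamma> k i m x * pderiv_at k f x * grad f' m x)"
    by (simp add: pderiv_gradient[OF x f'] second_pderiv_eq algebra_simps sum.distrib
        sum_subtractf sum_distrib_left sum_distrib_right ginv_sym[OF x])
  also have "(\<Sum>k\<in>UNIV. \<Sum>m\<in>UNIV. \<Gamma> m i k x * pderiv_at m f x * grad f' k x) =
      (\<Sum>k\<in>UNIV. \<Sum>m\<in>UNIV. \<Gamma> k i m x * pderiv_at k f x * grad f' m x)"
    by (rule sum.swap)
  also have "(\<Sum>k\<in>UNIV. \<Sum>j\<in>UNIV. H f' i j x * (ginv j k x * pderiv_at k f x)) =
      (\<Sum>k\<in>UNIV. H f' i k x * grad f k x)"
    by (subst sum.swap) (simp add: gradient_def sum_distrib_left)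
  finally show ?thesis by simp
qed

text \<open>The covariant derivative of the Hessian, the first index being the direction of differentiation.\<close>

definition dhess :: "(real ^ 'n \<Rightarrow> real) \<Rightarrow> 'n \<Rightarrow> 'n \<Rightarrow> 'n \<Rightarrow> real ^ 'n \<Rightarrow> real" where
  "dhess f l i k x = pderiv_at l (H f i k) x
    - (\<Sum>m\<in>UNIV. \<Gamma> m l k x * H f i m x) - (\<Sum>m\<in>UNIV. \<Gamma> m l i x * H f m k x)"

lemma dhess_sym:
  assumes x: "x \<in> S" and f: "smooth_on S f"
  shows "dhess f l i k x = dhess f l k i x"
proof -
  have "pderiv_at l (H f i k) x = pderiv_at l (H f k i) x"
    by (rule pderiv_at_cong[OF open_S x smooth_hessian[OF f]]) (rule hessian_sym[OF _ f])
  then show ?thesis by (simp add: dhess_def hessian_sym[OF x f, of i] hessian_sym[OF x f, of _ k])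
qed

text \<open>The third partial derivatives commute, so the antisymmetric part of the covariant derivative of the
  Hessian in the first two indices is of first order in \<open>f\<close>, with the curvature as its coefficient.\<close>

lemma ricci_identity:
  assumes x: "x \<in> S" and f: "smooth_on S f"
  shows "dhess f l k i x = dhess f k l i x - (\<Sum>m\<in>UNIV. riemann_curv G m l k i x * pderiv_at m f x)"
proof -
  have D: "pderiv_at l (H f k i) x = pderiv_at l (pderiv_at k (pderiv_at i f)) x
      - (\<Sum>m\<in>UNIV. pderiv_at l (\<Gamma> m k i) x * pderiv_at m f x)
      - (\<Sum>m\<in>UNIV. \<Gamma> m k i x * H f l m x)
      - (\<Sum>m\<in>UNIV. \<Sum>r\<in>UNIV. \<Gamma> m k i x * \<Gamma> r l m x * pderiv_at r f x)" for l k
  proof -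
    have e: "H f k i = (\<lambda>y. pderiv_at k (pderiv_at i f) y - (\<Sum>m\<in>UNIV. \<Gamma> m k i y * pderiv_at m f y))"
      by (simp add: hessian_comp_def fun_eq_iff)
    show ?thesis unfolding e using f
      by (simp add: pderiv_at_diff[of S, OF _ _ x] pderiv_at_sum[of _ S, OF _ x] pderiv_at_mult[OF _ _ x]
        smooth_intros smooth_christoffel second_pderiv_eq[of l _ f] sum.distrib distrib_left sum_distrib_left
        mult.assoc)
  qed
  have sw: "(\<Sum>m\<in>UNIV. \<Sum>r\<in>UNIV. \<Gamma> m k i x * \<Gamma> r l m x * pderiv_at r f x) =
    (\<Sum>m\<in>UNIV. (\<Sum>r\<in>UNIV. \<Gamma> r k i x * \<Gamma> m l r x) * pderiv_at m f x)" for l k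
    by (subst sum.swap) (simp add: sum_distrib_right)
  have c: "pderiv_at l (pderiv_at k (pderiv_at i f)) x = pderiv_at k (pderiv_at l (pderiv_at i f)) x"
    by (rule pderiv_at_commute[OF open_S x smooth_on_pderiv_at[OF f]])
  have R: "(\<Sum>m\<in>UNIV. riemann_curv G m l k i x * pderiv_at m f x) =
      (\<Sum>m\<in>UNIV. pderiv_at l (\<Gamma> m k i) x * pderiv_at m f x)
    - (\<Sum>m\<in>UNIV. pderiv_at k (\<Gamma> m l i) x * pderiv_at m f x)
    + (\<Sum>m\<in>UNIV. (\<Sum>r\<in>UNIV. \<Gamma> r k i x * \<Gamma> m l r x) * pderiv_at m f x)
    - (\<Sum>m\<in>UNIV. (\<Sum>r\<in>UNIV. \<Gamma> r l i x * \<Gamma> m k r x) * pderiv_at m f x)"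
    by (simp add: riemann_curv_def sum_subtractf left_diff_distrib distrib_right sum.distrib)
  show ?thesis
    by (simp add: dhess_def D[of l k] D[of k l] sw c R christoffel_sym[OF x, of _ k l])
qed

text \<open>Taking the trace commutes with covariant differentiation since the inverse metric is parallel.\<close>

lemma pderiv_laplacian:
  assumes x: "x \<in> S" and f: "smooth_on S f"
  shows "pderiv_at k (laplacian G f) x = (\<Sum>l\<in>UNIV. \<Sum>i\<in>UNIV. ginv l i x * dhess f k l i x)"
proof -
  have "pderiv_at k (laplacian G f) x =
    (\<Sum>l\<in>UNIV. \<Sum>i\<in>UNIV. pderiv_at k (ginv l i) x * H f l i x + ginv l i x * pderiv_at k (H f l i) x)"
    unfolding laplacian_def[abs_def] using f
    by (simp add: pderiv_at_sum[of _ S, OF _ x] pderiv_at_mult[OF _ _ x] smooth_intros smooth_hessian)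
  also have "\<dots> = (\<Sum>l\<in>UNIV. \<Sum>i\<in>UNIV. ginv l i x * pderiv_at k (H f l i) x)
     - (\<Sum>l\<in>UNIV. \<Sum>i\<in>UNIV. \<Sum>m\<in>UNIV. ginv m i x * (\<Gamma> l k m x * H f l i x))
     - (\<Sum>l\<in>UNIV. \<Sum>i\<in>UNIV. \<Sum>m\<in>UNIV. ginv l m x * (\<Gamma> i k m x * H f l i x))"
    by (simp add: pderiv_ginv[OF x] algebra_simps sum.distrib sum_subtractf sum_negf
        sum_distrib_left sum_distrib_right)
  also have "(\<Sum>l\<in>UNIV. \<Sum>i\<in>UNIV. \<Sum>m\<in>UNIV. ginv m i x * (\<Gamma> l k m x * H f l i x)) =
    (\<Sum>l\<in>UNIV. \<Sum>i\<in>UNIV. \<Sum>m\<in>UNIV. ginv l i x * (\<Gamma> m k l x * H f m i x))"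
  proof -
    have "(\<Sum>l\<in>UNIV. \<Sum>i\<in>UNIV. \<Sum>m\<in>UNIV. ginv m i x * (\<Gamma> l k m x * H f l i x)) =
      (\<Sum>i\<in>UNIV. \<Sum>l\<in>UNIV. \<Sum>m\<in>UNIV. ginv m i x * (\<Gamma> l k m x * H f l i x))"
      by (rule sum.swap)
    also have "\<dots> = (\<Sum>i\<in>UNIV. \<Sum>l\<in>UNIV. \<Sum>m\<in>UNIV. ginv l i x * (\<Gamma> m k l x * H f m i x))"
      by (rule sum.cong[OF refl], rule sum.swap)
    also have "\<dots> = (\<Sum>l\<in>UNIV. \<Sum>i\<in>UNIV. \<Sum>m\<in>UNIV. ginv l i x * (\<Gamma> m k l x * H f m i x))"
      by (rule sum.swap)
    finally show ?thesis .
  qed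
  also have "(\<Sum>l\<in>UNIV. \<Sum>i\<in>UNIV. \<Sum>m\<in>UNIV. ginv l m x * (\<Gamma> i k m x * H f l i x)) =
    (\<Sum>l\<in>UNIV. \<Sum>i\<in>UNIV. \<Sum>m\<in>UNIV. ginv l i x * (\<Gamma> m k i x * H f l m x))"
    by (rule sum.cong[OF refl], rule sum.swap)
  finally show ?thesis
    by (simp add: dhess_def right_diff_distrib sum_subtractf sum_distrib_left)
qed

lemma hessian_dot_grad:
  assumes x: "x \<in> S" and f: "smooth_on S f"
  shows "H (dot_grad f f) l i x = 2 * ((\<Sum>k\<in>UNIV. dhess f l i k x * grad f k x)
     + (\<Sum>k\<in>UNIV. \<Sum>j\<in>UNIV. H f i k x * ginv k j x * H f l j x))"
proof -
  have q: "pderiv_at i (dot_grad f f) y = (\<Sum>k\<in>UNIV. 2 * (H f i k y * grad f k y))" if "y \<in> S" for y i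
    by (simp add: pderiv_dot_grad[OF that f f] sum_distrib_left[symmetric])
  have "pderiv_at l (pderiv_at i (dot_grad f f)) x = pderiv_at l (\<lambda>y. \<Sum>k\<in>UNIV. 2 * (H f i k y * grad f k y)) x"
    by (rule pderiv_at_cong[OF open_S x]) (intro smooth_intros smooth_dot_grad f, rule q)
  also have "\<dots> = (\<Sum>k\<in>UNIV. 2 * (pderiv_at l (H f i k) x * grad f k x + H f i k x * pderiv_at l (\<lambda>y. grad f k y) x))"
    using f by (simp add: pderiv_at_sum[of _ S, OF _ x] pderiv_at_mult[OF _ _ x] smooth_intros
        smooth_hessian smooth_gradient pderiv_at_const)
  also have "\<dots> = 2 * ((\<Sum>k\<in>UNIV. pderiv_at l (H f i k) x * grad f k x)
      + (\<Sum>k\<in>UNIV. \<Sum>j\<in>UNIV. H f i k x * ginv k j x * H f l j x)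
      - (\<Sum>k\<in>UNIV. \<Sum>m\<in>UNIV. H f i k x * \<Gamma> k l m x * grad f m x))"
    by (simp add: pderiv_gradient[OF x f] sum_distrib_left[symmetric] sum.distrib)
      (simp add: sum_distrib_left sum_subtractf right_diff_distrib mult.assoc)
  also have "(\<Sum>k\<in>UNIV. \<Sum>m\<in>UNIV. H f i k x * \<Gamma> k l m x * grad f m x) =
      (\<Sum>k\<in>UNIV. (\<Sum>m\<in>UNIV. \<Gamma> m l k x * H f i m x) * grad f k x)"
    by (subst sum.swap) (simp add: sum_distrib_left sum_distrib_right mult_ac)
  finally have D: "pderiv_at l (pderiv_at i (dot_grad f f)) x = 2 * ((\<Sum>k\<in>UNIV. pderiv_at l (H f i k) x * grad f k x)
      + (\<Sum>k\<in>UNIV. \<Sum>j\<in>UNIV. H f i k x * ginv k j x * H f l j x)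
      - (\<Sum>k\<in>UNIV. (\<Sum>m\<in>UNIV. \<Gamma> m l k x * H f i m x) * grad f k x))" .
  have "(\<Sum>m\<in>UNIV. \<Gamma> m l i x * pderiv_at m (dot_grad f f) x) =
      2 * (\<Sum>m\<in>UNIV. \<Sum>k\<in>UNIV. \<Gamma> m l i x * H f m k x * grad f k x)"
    by (simp add: q[OF x] sum_distrib_left mult_ac)
  also have "(\<Sum>m\<in>UNIV. \<Sum>k\<in>UNIV. \<Gamma> m l i x * H f m k x * grad f k x) =
      (\<Sum>k\<in>UNIV. (\<Sum>m\<in>UNIV. \<Gamma> m l i x * H f m k x) * grad f k x)"
    by (subst sum.swap) (simp add: sum_distrib_right)
  finally show ?thesis
    by (simp add: hessian_comp_def[of G "dot_grad f f"] D dhess_def left_diff_distrib sum_subtractf)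
qed

definition tensor_norm_sq :: "('n \<Rightarrow> 'n \<Rightarrow> real) \<Rightarrow> real ^ 'n \<Rightarrow> real" where
  "tensor_norm_sq A x = (\<Sum>l\<in>UNIV. \<Sum>i\<in>UNIV. ginv l i x *
     (\<Sum>k\<in>UNIV. \<Sum>j\<in>UNIV. A i k * ginv k j x * A l j))"

abbreviation "hess_norm_sq f x \<equiv> tensor_norm_sq (\<lambda>i j. H f i j x) x"

text \<open>In the trace of the Hessian of \<open>\<bar>\<nabla>f\<bar>\<^sup>2\<close> the second derivatives of \<open>\<nabla>f\<close> are traced over the direction
  of differentiation. Symmetry of the Hessian and the Ricci identity move the trace to the
  Hessian itself, where it gives the derivative of the Laplacian.\<close>

lemma bochner:
  assumes x: "x \<in> S" and f: "smooth_on S f"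
  shows "laplacian G (dot_grad f f) x = 2 * (hess_norm_sq f x
    + (\<Sum>k\<in>UNIV. grad f k x * pderiv_at k (laplacian G f) x)
    + ricci G x (gradient G f x) (gradient G f x))"
proof -
  let ?A = "\<Sum>l\<in>UNIV. \<Sum>i\<in>UNIV. ginv l i x * (\<Sum>k\<in>UNIV. dhess f l i k x * grad f k x)"
  have "laplacian G (dot_grad f f) x = 2 * (?A + hess_norm_sq f x)"
    unfolding laplacian_def tensor_norm_sq_def hessian_dot_grad[OF x f]
    by (simp add: distrib_left sum.distrib sum_distrib_left mult_ac)
  moreover have "?A = (\<Sum>k\<in>UNIV. grad f k x * pderiv_at k (laplacian G f) x)
      + ricci G x (gradient G f x) (gradient G f x)"
  proof -
    have "?A = (\<Sum>l\<in>UNIV. \<Sum>i\<in>UNIV. \<Sum>k\<in>UNIV. grad f k x * (ginv l i x * dhess f l k i x))"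
      by (simp add: sum_distrib_left dhess_sym[OF x f, of _ _ i for i] mult_ac)
    also have "\<dots> = (\<Sum>k\<in>UNIV. grad f k x * (\<Sum>l\<in>UNIV. \<Sum>i\<in>UNIV. ginv l i x * dhess f l k i x))"
      by (subst sum_rotate) (simp add: sum_distrib_left)
    also have "\<dots> = (\<Sum>k\<in>UNIV. grad f k x * (pderiv_at k (laplacian G f) x
       + (\<Sum>j\<in>UNIV. (\<Sum>l\<in>UNIV. riemann_curv G l l k j x) * grad f j x)))"
    proof -
      have "(\<Sum>l\<in>UNIV. \<Sum>i\<in>UNIV. ginv l i x * dhess f l k i x) = pderiv_at k (laplacian G f) x
       + (\<Sum>j\<in>UNIV. (\<Sum>l\<in>UNIV. riemann_curv G l l k j x) * grad f j x)" for k
        using curv_contraction[OF x, of k "\<lambda>m. pderiv_at m f x"]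
        by (simp add: ricci_identity[OF x f, of _ k] pderiv_laplacian[OF x f] right_diff_distrib
            sum_subtractf gradient_def)
      then show ?thesis by simp
    qed
    finally show ?thesis
      by (simp add: ricci_def distrib_left sum.distrib sum_distrib_left mult_ac)
  qed
  ultimately show ?thesis by simp
qed

lemma weighted_laplacian_eq:
  "x \<in> S \<Longrightarrow> weighted_laplacian G \<psi> f x = laplacian G f x - dot_grad f \<psi> x"
  by (simp add: weighted_laplacian_def metric_inner_gradients)

text \<open>The drift term contributes the Hessian of the weight: the derivative of \<open>\<langle>\<nabla>f, \<nabla>\<psi>\<rangle>\<close> along
  \<open>\<nabla>f\<close> contains, besides this Hessian, the Hessian of \<open>f\<close> at \<open>\<nabla>f\<close> and \<open>\<nabla>\<psi>\<close>, which is half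
  the drift applied to \<open>\<bar>\<nabla>f\<bar>\<^sup>2\<close>.\<close>

lemma weighted_bochner:
  assumes x: "x \<in> S" and f: "smooth_on S f" and \<psi>: "smooth_on S \<psi>"
  shows "weighted_laplacian G \<psi> (dot_grad f f) x = 2 * (hess_norm_sq f x
    + (\<Sum>k\<in>UNIV. grad f k x * pderiv_at k (weighted_laplacian G \<psi> f) x)
    + ricci G x (gradient G f x) (gradient G f x)
    + hessian G \<psi> x (gradient G f x) (gradient G f x))"
proof -
  have 1: "dot_grad (dot_grad f f) \<psi> x = 2 * (\<Sum>k\<in>UNIV. \<Sum>m\<in>UNIV. H f k m x * grad f m x * grad \<psi> k x)"
    unfolding dot_grad_def[of "dot_grad f f"]
    by (simp add: pderiv_dot_grad[OF x f f] sum_distrib_left sum_distrib_right mult_ac)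
  have "pderiv_at k (weighted_laplacian G \<psi> f) x = pderiv_at k (\<lambda>y. laplacian G f y - dot_grad f \<psi> y) x" for k
    by (rule pderiv_at_cong[OF open_S x, symmetric])
      (intro smooth_intros smooth_laplacian smooth_dot_grad f \<psi>, rule weighted_laplacian_eq[symmetric])
  then have 2: "pderiv_at k (weighted_laplacian G \<psi> f) x = pderiv_at k (laplacian G f) x
     - (\<Sum>m\<in>UNIV. H f k m x * grad \<psi> m x) - (\<Sum>m\<in>UNIV. H \<psi> k m x * grad f m x)" for k
    by (simp add: pderiv_at_diff[OF smooth_laplacian[OF f] smooth_dot_grad[OF f \<psi>] x] pderiv_dot_grad[OF x f \<psi>])
  have 3: "(\<Sum>k\<in>UNIV. \<Sum>m\<in>UNIV. grad f k x * (H f k m x * grad \<psi> m x)) =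
    (\<Sum>k\<in>UNIV. \<Sum>m\<in>UNIV. H f k m x * grad f m x * grad \<psi> k x)"
    by (subst sum.swap) (simp add: hessian_sym[OF x f] mult_ac)
  have 4: "(\<Sum>k\<in>UNIV. grad f k x * pderiv_at k (weighted_laplacian G \<psi> f) x) =
    (\<Sum>k\<in>UNIV. grad f k x * pderiv_at k (laplacian G f) x)
    - (\<Sum>k\<in>UNIV. \<Sum>m\<in>UNIV. grad f k x * (H f k m x * grad \<psi> m x))
    - hessian G \<psi> x (gradient G f x) (gradient G f x)"
    by (simp add: 2 hessian_def right_diff_distrib sum_subtractf sum_distrib_left mult_ac)
  show ?thesis
    unfolding weighted_laplacian_eq[OF x] bochner[OF x f] 1 4 3 by simp
qed

end

section \<open>Traces of products of positive semidefinite matrices\<close>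

definition psd :: "('n::finite \<Rightarrow> 'n \<Rightarrow> real) \<Rightarrow> bool" where
  "psd a \<longleftrightarrow> (\<forall>i j. a i j = a j i) \<and> (\<forall>v. 0 \<le> (\<Sum>i\<in>UNIV. \<Sum>j\<in>UNIV. v i * v j * a i j))"

lemma psd_sym: "psd a \<Longrightarrow> a i j = a j i"
  unfolding psd_def by blast

lemma psd_quadratic_form: "psd a \<Longrightarrow> 0 \<le> (\<Sum>i\<in>UNIV. \<Sum>j\<in>UNIV. v i * v j * a i j)"
  by (simp add: psd_def)

lemma quadratic_form_shift:
  fixes a :: "'n::finite \<Rightarrow> 'n \<Rightarrow> real"
  assumes "\<And>i j. a i j = a j i"
  shows "(\<Sum>i\<in>UNIV. \<Sum>j\<in>UNIV. (v i + (if i = k then t else 0)) * (v j + (if j = k then t else 0)) * a i j) =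
    (\<Sum>i\<in>UNIV. \<Sum>j\<in>UNIV. v i * v j * a i j) + 2 * t * (\<Sum>i\<in>UNIV. v i * a i k) + t\<^sup>2 * a k k"
proof -
  let ?d = "\<lambda>i. if i = k then t else 0"
  have d: "(\<Sum>j\<in>UNIV. ?d j * b j) = t * b k" for b :: "'n \<Rightarrow> real"
    by (simp add: if_distrib[of "\<lambda>c. c * _"] cong: if_cong)
  have "(\<Sum>i\<in>UNIV. \<Sum>j\<in>UNIV. (v i + ?d i) * (v j + ?d j) * a i j) =
    (\<Sum>i\<in>UNIV. \<Sum>j\<in>UNIV. v i * v j * a i j) + (\<Sum>i\<in>UNIV. v i * (\<Sum>j\<in>UNIV. ?d j * a i j))
     + (\<Sum>i\<in>UNIV. ?d i * (\<Sum>j\<in>UNIV. v j * a i j)) + (\<Sum>i\<in>UNIV. ?d i * (\<Sum>j\<in>UNIV. ?d j * a i j))"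
    by (simp only: sum.distrib[symmetric] sum_distrib_left) (simp add: algebra_simps)
  moreover have "(\<Sum>j\<in>UNIV. v j * a k j) = (\<Sum>j\<in>UNIV. v j * a j k)"
    by (intro sum.cong refl arg_cong2[of _ _ _ _ "(*)"] assms)
  moreover have "(\<Sum>i\<in>UNIV. v i * (t * a i k)) = t * (\<Sum>i\<in>UNIV. v i * a i k)"
    by (simp add: sum_distrib_left mult_ac)
  ultimately show ?thesis
    unfolding d by (simp add: power2_eq_square)
qed

lemma psd_diag_nonneg:
  assumes "psd a" shows "0 \<le> a k k"
proof -
  have s: "\<And>i j. a i j = a j i" by (rule psd_sym[OF assms])
  have "0 \<le> (\<Sum>i\<in>UNIV. \<Sum>j\<in>UNIV. (0 + (if i = k then 1 else 0)) * (0 + (if j = k then 1 else 0)) * a i j)"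
    by (rule psd_quadratic_form[OF assms, of "\<lambda>i. 0 + (if i = k then 1 else 0)"])
  then show ?thesis unfolding quadratic_form_shift[OF s] by simp
qed

lemma psd_zero_row:
  assumes "psd a" "a k k = 0" "a j j = 0" shows "a j k = 0"
proof (rule ccontr)
  assume nz: "a j k \<noteq> 0"
  have s: "\<And>i j. a i j = a j i" by (rule psd_sym[OF assms(1)])
  define t where "t = - 1 / a j k"
  let ?e = "\<lambda>i. 0 + (if i = j then 1 else 0) :: real"
  have e: "(\<Sum>i\<in>UNIV. ?e i * a i k) = a j k"
    by (simp add: if_distrib[of "\<lambda>c. c * _"] cong: if_cong)
  have "0 \<le> (\<Sum>i\<in>UNIV. \<Sum>j\<in>UNIV. (?e i + (if i = k then t else 0)) * (?e j + (if j = k then t else 0)) * a i j)"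
    by (rule psd_quadratic_form[OF assms(1), of "\<lambda>i. ?e i + (if i = k then t else 0)"])
  also have "\<dots> = (\<Sum>i\<in>UNIV. \<Sum>j\<in>UNIV. ?e i * ?e j * a i j) + 2 * t * a j k + t\<^sup>2 * a k k"
    unfolding quadratic_form_shift[OF s] e ..
  also have "(\<Sum>i\<in>UNIV. \<Sum>j\<in>UNIV. ?e i * ?e j * a i j) = a j j"
    unfolding quadratic_form_shift[OF s] by simp
  finally show False using nz assms(2,3) by (simp add: t_def)
qed

text \<open>Subtracting from \<open>a\<close> the rank one matrix built from the \<open>k\<close>-th column, with
  \<open>a k k > 0\<close>, leaves a positive semidefinite matrix with vanishing \<open>k\<close>-th row (its quadratic form is
  the minimum of that of \<open>a\<close> in the \<open>k\<close>-th variable). By induction \<open>a\<close> is a sum of such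
  rank one matrices, whose pairing with \<open>b\<close> is a value of the quadratic form of \<open>b\<close>.\<close>

lemma psd_trace_nonneg:
  fixes a b :: "'n::finite \<Rightarrow> 'n \<Rightarrow> real"
  assumes "psd a" "psd b"
  shows "0 \<le> (\<Sum>i\<in>UNIV. \<Sum>j\<in>UNIV. a i j * b i j)"
  using assms(1)
proof (induction "card {i. \<exists>j. a i j \<noteq> 0}" arbitrary: a rule: less_induct)
  case less
  have s: "\<And>i j. a i j = a j i" by (rule psd_sym[OF less.prems])
  show ?case
  proof (cases "\<forall>k. a k k = 0")
    case True
    then have "a i j = 0" for i j using psd_zero_row[OF less.prems] by blast
    then show ?thesis by simp
  next
    case False
    then obtain k where "a k k \<noteq> 0" by blast
    then have k: "a k k > 0" using psd_diag_nonneg[OF less.prems, of k] by simp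
    define a' where "a' i j = a i j - a i k * a j k / a k k" for i j
    have "psd a'"
      unfolding psd_def
    proof (intro conjI allI)
      show "a' i j = a' j i" for i j by (simp add: a'_def s[of i j] mult.commute)
      fix v :: "'n \<Rightarrow> real"
      define r where "r = (\<Sum>i\<in>UNIV. v i * a i k)"
      define t where "t = - r / a k k"
      have "0 \<le> (\<Sum>i\<in>UNIV. \<Sum>j\<in>UNIV. (v i + (if i = k then t else 0)) * (v j + (if j = k then t else 0)) * a i j)"
        by (rule psd_quadratic_form[OF less.prems, of "\<lambda>i. v i + (if i = k then t else 0)"])
      also have "\<dots> = (\<Sum>i\<in>UNIV. \<Sum>j\<in>UNIV. v i * v j * a i j) + 2 * t * r + t\<^sup>2 * a k k"
        unfolding quadratic_form_shift[OF s] r_def ..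
      also have "\<dots> = (\<Sum>i\<in>UNIV. \<Sum>j\<in>UNIV. v i * v j * a i j) - r * r / a k k"
        using k by (simp add: t_def field_simps power2_eq_square)
      also have "r * r / a k k = (\<Sum>i\<in>UNIV. \<Sum>j\<in>UNIV. v i * v j * (a i k * a j k / a k k))"
        unfolding r_def sum_product by (simp add: sum_divide_distrib mult_ac)
      finally show "0 \<le> (\<Sum>i\<in>UNIV. \<Sum>j\<in>UNIV. v i * v j * a' i j)"
        by (simp add: a'_def right_diff_distrib sum_subtractf)
    qed
    moreover have "card {i. \<exists>j. a' i j \<noteq> 0} < card {i. \<exists>j. a i j \<noteq> 0}"
    proof (rule psubset_card_mono)
      have "a' k j = 0" for j using k by (simp add: a'_def s[of k j])
      moreover have "a' i j = 0" if "\<And>l. a i l = 0" for i j using that by (simp add: a'_def)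
      ultimately show "{i. \<exists>j. a' i j \<noteq> 0} \<subset> {i. \<exists>j. a i j \<noteq> 0}" using k by fastforce
    qed simp
    ultimately have "0 \<le> (\<Sum>i\<in>UNIV. \<Sum>j\<in>UNIV. a' i j * b i j)" using less.hyps by blast
    moreover have "0 \<le> (\<Sum>i\<in>UNIV. \<Sum>j\<in>UNIV. a i k * a j k * b i j) / a k k"
      by (rule divide_nonneg_pos[OF psd_quadratic_form[OF assms(2), of "\<lambda>i. a i k"] k])
    moreover have "(\<Sum>i\<in>UNIV. \<Sum>j\<in>UNIV. a i j * b i j) = (\<Sum>i\<in>UNIV. \<Sum>j\<in>UNIV. a' i j * b i j)
      + (\<Sum>i\<in>UNIV. \<Sum>j\<in>UNIV. a i k * a j k * b i j) / a k k"
      by (simp add: a'_def left_diff_distrib sum_subtractf sum_divide_distrib)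
    ultimately show ?thesis by linarith
  qed
qed

section \<open>The curvature-dimension inequality\<close>

context local_metric
begin

lemma psd_ginv: assumes x: "x \<in> S" shows "psd (\<lambda>i j. ginv i j x)"
  unfolding psd_def
proof (intro conjI allI)
  show "ginv i j x = ginv j i x" for i j by (rule ginv_sym[OF x])
  fix v :: "'n \<Rightarrow> real"
  define w where "w = matrix_inv (G x) *v (\<chi> i. v i)"
  have "0 \<le> w \<bullet> (G x *v w)" using pos_G[OF x, of w] by (cases "w = 0") auto
  also have "G x *v w = (\<chi> i. v i)" by (simp add: w_def matrix_vector_mul_assoc G_ginv[OF x])
  also have "w \<bullet> (\<chi> i. v i) = (\<Sum>i\<in>UNIV. \<Sum>j\<in>UNIV. v i * v j * ginv i j x)"
    by (simp add: w_def inner_vec_def matrix_vector_mult_def inverse_metric_def sum_distrib_left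
        sum_distrib_right mult_ac)
  finally show "0 \<le> (\<Sum>i\<in>UNIV. \<Sum>j\<in>UNIV. v i * v j * ginv i j x)" .
qed

lemma dot_grad_eq: "dot_grad f f' x = (\<Sum>i\<in>UNIV. \<Sum>j\<in>UNIV. pderiv_at i f x * pderiv_at j f' x * ginv i j x)"
  by (simp add: dot_grad_def gradient_def sum_distrib_left mult_ac)

lemma dot_grad_nonneg: "x \<in> S \<Longrightarrow> 0 \<le> dot_grad f f x"
  unfolding dot_grad_eq by (rule psd_quadratic_form[OF psd_ginv, of x "\<lambda>i. pderiv_at i f x"])

text \<open>The inner double sum is, in its free indices, the Gram matrix of the rows of \<open>A\<close>, hence positive
  semidefinite, and the outer one is its trace against the inverse metric.\<close>

lemma tensor_norm_sq_nonneg: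
  assumes x: "x \<in> S"
  shows "0 \<le> tensor_norm_sq A x"
  unfolding tensor_norm_sq_def
proof (rule psd_trace_nonneg[OF psd_ginv[OF x]])
  let ?B = "\<lambda>l i. \<Sum>k\<in>UNIV. \<Sum>j\<in>UNIV. A i k * ginv k j x * A l j"
  show "psd ?B"
    unfolding psd_def
  proof (intro conjI allI)
    show "?B l i = ?B i l" for l i
      by (subst sum.swap) (simp add: ginv_sym[OF x] mult_ac)
    fix v :: "'n \<Rightarrow> real"
    have "0 \<le> (\<Sum>k\<in>UNIV. \<Sum>j\<in>UNIV. (\<Sum>i\<in>UNIV. v i * A i k) * (\<Sum>i\<in>UNIV. v i * A i j) * ginv k j x)"
      by (rule psd_quadratic_form[OF psd_ginv[OF x], of "\<lambda>k. \<Sum>i\<in>UNIV. v i * A i k"])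
    also have "\<dots> = (\<Sum>k\<in>UNIV. \<Sum>j\<in>UNIV. \<Sum>i\<in>UNIV. \<Sum>l\<in>UNIV. v l * v i * (A i k * ginv k j x * A l j))"
      by (intro sum.cong refl, subst sum_product, simp only: sum_distrib_right, simp only: mult_ac)
    also have "\<dots> = (\<Sum>i\<in>UNIV. \<Sum>k\<in>UNIV. \<Sum>j\<in>UNIV. \<Sum>l\<in>UNIV. v l * v i * (A i k * ginv k j x * A l j))"
      by (rule sum_rotate)
    also have "\<dots> = (\<Sum>i\<in>UNIV. \<Sum>l\<in>UNIV. \<Sum>k\<in>UNIV. \<Sum>j\<in>UNIV. v l * v i * (A i k * ginv k j x * A l j))"
      by (rule sum.cong[OF refl], rule sum_rotate)
    also have "\<dots> = (\<Sum>l\<in>UNIV. \<Sum>i\<in>UNIV. v l * v i * ?B l i)"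
      by (subst sum.swap) (simp add: sum_distrib_left)
    finally show "0 \<le> (\<Sum>l\<in>UNIV. \<Sum>i\<in>UNIV. v l * v i * ?B l i)" .
  qed
qed

lemma contract_right: 
  assumes x: "x \<in> S"
  shows "(\<Sum>k\<in>UNIV. \<Sum>j\<in>UNIV. X k * ginv k j x * G x $ l $ j) = X l"
proof -
  have "(\<Sum>k\<in>UNIV. \<Sum>j\<in>UNIV. X k * ginv k j x * G x $ l $ j) =
    (\<Sum>k\<in>UNIV. X k * (\<Sum>j\<in>UNIV. ginv k j x * G x $ j $ l))"
    by (simp add: sum_distrib_left G_sym[OF x, of l] mult_ac)
  also have "\<dots> = X l" by (simp add: ginv_G_sum[OF x] if_distrib cong: if_cong)
  finally show ?thesis .
qed

lemma contract_left: 
  assumes x: "x \<in> S"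
  shows "(\<Sum>k\<in>UNIV. \<Sum>j\<in>UNIV. G x $ l $ k * ginv k j x * Y j) = Y l"
  using contract_right[OF x, of Y l]
  by (subst sum.swap) (simp add: ginv_sym[OF x] mult_ac)

text \<open>The difference of the two sides is the square norm of the trace-free part of the Hessian.\<close>

lemma laplacian_sq_le:
  assumes x: "x \<in> S" and f: "smooth_on S f"
  shows "(laplacian G f x)\<^sup>2 / real CARD('n) \<le> hess_norm_sq f x"
proof -
  define c where "c = laplacian G f x / real CARD('n)"
  have e: "(\<Sum>k\<in>UNIV. \<Sum>j\<in>UNIV. (H f i k x - c * G x $ i $ k) * ginv k j x * (H f l j x - c * G x $ l $ j)) =
    (\<Sum>k\<in>UNIV. \<Sum>j\<in>UNIV. H f i k x * ginv k j x * H f l j x) - 2 * c * H f l i x + c\<^sup>2 * G x $ l $ i" for i l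
  proof -
    have "(\<Sum>k\<in>UNIV. \<Sum>j\<in>UNIV. (H f i k x - c * G x $ i $ k) * ginv k j x * (H f l j x - c * G x $ l $ j)) =
      (\<Sum>k\<in>UNIV. \<Sum>j\<in>UNIV. H f i k x * ginv k j x * H f l j x)
      - c * (\<Sum>k\<in>UNIV. \<Sum>j\<in>UNIV. H f i k x * ginv k j x * G x $ l $ j)
      - c * (\<Sum>k\<in>UNIV. \<Sum>j\<in>UNIV. G x $ i $ k * ginv k j x * H f l j x)
      + c\<^sup>2 * (\<Sum>k\<in>UNIV. \<Sum>j\<in>UNIV. G x $ i $ k * ginv k j x * G x $ l $ j)"
      by (simp only: sum.distrib[symmetric] sum_subtractf[symmetric] sum_distrib_left)
        (simp add: algebra_simps power2_eq_square)
    then show ?thesis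
      using hessian_sym[OF x f, of i l] G_sym[OF x, of i l]
      by (simp add: contract_right[OF x] contract_left[OF x])
  qed
  have tr: "(\<Sum>l\<in>UNIV. \<Sum>i\<in>UNIV. ginv l i x * G x $ l $ i) = real CARD('n)"
  proof -
    have "(\<Sum>l\<in>UNIV. \<Sum>i\<in>UNIV. ginv l i x * G x $ l $ i) = (\<Sum>l\<in>UNIV. \<Sum>i\<in>UNIV. ginv l i x * G x $ i $ l)"
      by (intro sum.cong refl arg_cong2[of _ _ _ _ "(*)"] G_sym[OF x])
    then show ?thesis by (simp add: ginv_G_sum[OF x])
  qed
  have "0 \<le> tensor_norm_sq (\<lambda>i k. H f i k x - c * G x $ i $ k) x"
    by (rule tensor_norm_sq_nonneg[OF x])
  also have "\<dots> = hess_norm_sq f x - 2 * c * laplacian G f x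
      + c\<^sup>2 * (\<Sum>l\<in>UNIV. \<Sum>i\<in>UNIV. ginv l i x * G x $ l $ i)"
    unfolding tensor_norm_sq_def e laplacian_def
    by (simp add: algebra_simps sum.distrib sum_subtractf sum_distrib_left)
  also have "\<dots> = hess_norm_sq f x - (laplacian G f x)\<^sup>2 / real CARD('n)"
    unfolding tr c_def by (simp add: power2_eq_square field_simps)
  finally show ?thesis by simp
qed

text \<open>The difference of the two sides is a multiple of the square of a linear form in \<open>a\<close> and \<open>b\<close>. The
  factor is positive because \<open>N\<close> and \<open>N - n\<close> have the same sign.\<close>

lemma negative_dimension_square:
  fixes a b n N :: real
  assumes "n > 0" "N < 0"
  shows "a\<^sup>2 / N \<le> (a + b)\<^sup>2 / n + b\<^sup>2 / (N - n)"
proof -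
  have "(a + b)\<^sup>2 / n + b\<^sup>2 / (N - n) - a\<^sup>2 / N = ((N - n) * a + N * b)\<^sup>2 / (n * N * (N - n))"
    using assms by (simp add: field_simps) (simp add: algebra_simps power2_eq_square)
  moreover have "0 < n * N * (N - n)"
    using assms by (simp add: mult_pos_neg mult_neg_neg)
  ultimately show ?thesis by (metis diff_ge_0_iff_ge divide_nonneg_pos zero_le_power2)
qed

text \<open>The negative dimension compensates the weight: with \<open>a = L f\<close> and \<open>b = \<langle>\<nabla>f, \<nabla>\<psi>\<rangle>\<close>, so that
  \<open>a + b = \<Delta>f\<close>, the quadratic inequality bounds the square of the Hessian together with the last
  term of the weighted Ricci curvature.\<close>

lemma weighted_bochner_inequality:
  assumes x: "x \<in> S" and f: "smooth_on S f" and \<psi>: "smooth_on S \<psi>" and N: "N < 0"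
    and ric: "\<And>v. K * metric_inner G x v v \<le> weighted_ricci N G \<psi> x v"
  shows "2 * ((weighted_laplacian G \<psi> f x)\<^sup>2 / N
    + (\<Sum>k\<in>UNIV. grad f k x * pderiv_at k (weighted_laplacian G \<psi> f) x)
    + K * dot_grad f f x) \<le> weighted_laplacian G \<psi> (dot_grad f f) x"
proof -
  let ?n = "real CARD('n)"
  have m: "metric_inner G x (gradient G \<psi> x) (gradient G f x) = dot_grad f \<psi> x"
    by (simp add: metric_inner_gradients[OF x] dot_grad_sym[OF x, of \<psi>])
  have "K * dot_grad f f x \<le> ricci G x (gradient G f x) (gradient G f x)
      + hessian G \<psi> x (gradient G f x) (gradient G f x) - (dot_grad f \<psi> x)\<^sup>2 / (N - ?n)"
    using ric[of "gradient G f x"] unfolding weighted_ricci_def m unfolding metric_inner_gradients[OF x] .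
  moreover have "(weighted_laplacian G \<psi> f x)\<^sup>2 / N \<le>
      (weighted_laplacian G \<psi> f x + dot_grad f \<psi> x)\<^sup>2 / ?n + (dot_grad f \<psi> x)\<^sup>2 / (N - ?n)"
    by (rule negative_dimension_square) (use N in auto)
  moreover have "(weighted_laplacian G \<psi> f x + dot_grad f \<psi> x)\<^sup>2 / ?n \<le> hess_norm_sq f x"
    using laplacian_sq_le[OF x f] by (simp add: weighted_laplacian_eq[OF x])
  ultimately show ?thesis unfolding weighted_bochner[OF x f \<psi>] by simp
qed

section \<open>A subharmonic function\<close>

lemma weighted_laplacian_add_scale:
  assumes x: "x \<in> S" and f: "smooth_on S f" and f': "smooth_on S f'"
  shows "weighted_laplacian G \<psi> (\<lambda>y. f y + c * f' y) x =
    weighted_laplacian G \<psi> f x + c * weighted_laplacian G \<psi> f' x"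
proof -
  have p: "pderiv_at i (\<lambda>y. f y + c * f' y) y = pderiv_at i f y + c * pderiv_at i f' y" if "y \<in> S" for i y
    using that f f' by (simp add: pderiv_at_add[of S] pderiv_at_mult[of S] smooth_intros pderiv_at_const)
  have pp: "pderiv_at j (pderiv_at i (\<lambda>y. f y + c * f' y)) x =
      pderiv_at j (pderiv_at i f) x + c * pderiv_at j (pderiv_at i f') x" for i j
  proof -
    have "pderiv_at j (pderiv_at i (\<lambda>y. f y + c * f' y)) x = pderiv_at j (\<lambda>y. pderiv_at i f y + c * pderiv_at i f' y) x"
      by (rule pderiv_at_cong[OF open_S x]) (intro smooth_intros f f', rule p)
    also have "\<dots> = pderiv_at j (pderiv_at i f) x + c * pderiv_at j (pderiv_at i f') x"
      using x f f' by (simp add: pderiv_at_add[of S] pderiv_at_mult[of S] smooth_intros pderiv_at_const)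
    finally show ?thesis .
  qed
  show ?thesis
    unfolding weighted_laplacian_eq[OF x] laplacian_def hessian_comp_def dot_grad_def pp p[OF x]
    by (simp add: algebra_simps sum.distrib sum_subtractf sum_distrib_left)
qed

lemma weighted_laplacian_square:
  assumes x: "x \<in> S" and f: "smooth_on S f"
  shows "weighted_laplacian G \<psi> (\<lambda>y. f y * f y) x =
    2 * (f x * weighted_laplacian G \<psi> f x + dot_grad f f x)"
proof -
  have p: "pderiv_at i (\<lambda>y. f y * f y) y = 2 * (f y * pderiv_at i f y)" if "y \<in> S" for i y
    using that f by (simp add: pderiv_at_mult[of S])
  have pp: "pderiv_at j (pderiv_at i (\<lambda>y. f y * f y)) x =
      2 * (f x * pderiv_at j (pderiv_at i f) x + pderiv_at j f x * pderiv_at i f x)" for i j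
  proof -
    have "pderiv_at j (pderiv_at i (\<lambda>y. f y * f y)) x = pderiv_at j (\<lambda>y. 2 * (f y * pderiv_at i f y)) x"
      by (rule pderiv_at_cong[OF open_S x]) (intro smooth_intros f, rule p)
    also have "\<dots> = 2 * (f x * pderiv_at j (pderiv_at i f) x + pderiv_at j f x * pderiv_at i f x)"
      using x f by (simp add: pderiv_at_mult[of S] smooth_intros pderiv_at_const)
    finally show ?thesis .
  qed
  show ?thesis
    unfolding weighted_laplacian_eq[OF x] laplacian_def hessian_comp_def dot_grad_eq pp p[OF x]
    by (simp add: algebra_simps sum.distrib sum_subtractf sum_distrib_left)
qed

text \<open>The factor \<open>\<mu> / N\<close> is chosen to cancel the term \<open>(L f)\<^sup>2 / N = \<mu>\<^sup>2 f\<^sup>2 / N\<close> against the zeroth order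
  part of \<open>L f\<^sup>2\<close>; only multiples of \<open>\<bar>\<nabla>f\<bar>\<^sup>2\<close> remain.\<close>

lemma eigenfunction_subharmonic:
  assumes x: "x \<in> S" and f: "smooth_on S f" and \<psi>: "smooth_on S \<psi>" and N: "N < 0"
    and ric: "\<And>v. K * metric_inner G x v v \<le> weighted_ricci N G \<psi> x v"
    and eigen: "\<And>y. y \<in> S \<Longrightarrow> weighted_laplacian G \<psi> f y = - \<mu> * f y"
  shows "2 * (K - \<mu> * (N - 1) / N) * dot_grad f f x \<le>
    weighted_laplacian G \<psi> (\<lambda>y. dot_grad f f y + \<mu> / N * (f y * f y)) x"
proof -
  have "pderiv_at k (weighted_laplacian G \<psi> f) x = - \<mu> * pderiv_at k f x" for k
  proof -
    have "pderiv_at k (\<lambda>y. - \<mu> * f y) x = pderiv_at k (weighted_laplacian G \<psi> f) x"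
      by (rule pderiv_at_cong[OF open_S x]) (intro smooth_intros f, rule eigen[symmetric])
    then show ?thesis
      using x f by (simp add: pderiv_at_minus[of S] pderiv_at_mult[of S] smooth_intros pderiv_at_const)
  qed
  then have "(\<Sum>k\<in>UNIV. grad f k x * pderiv_at k (weighted_laplacian G \<psi> f) x) = - \<mu> * dot_grad f f x"
    by (simp add: dot_grad_def sum_distrib_left mult_ac sum_negf)
  then have "2 * ((\<mu> * f x)\<^sup>2 / N - \<mu> * dot_grad f f x + K * dot_grad f f x)
      \<le> weighted_laplacian G \<psi> (dot_grad f f) x"
    using weighted_bochner_inequality[OF x f \<psi> N ric] by (simp add: eigen[OF x])
  moreover have "weighted_laplacian G \<psi> (\<lambda>y. dot_grad f f y + \<mu> / N * (f y * f y)) x =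
      weighted_laplacian G \<psi> (dot_grad f f) x + \<mu> / N * (2 * (- \<mu> * (f x * f x) + dot_grad f f x))"
    unfolding weighted_laplacian_add_scale[OF x smooth_dot_grad[OF f f] smooth_on_mult[OF open_S f f]]
      weighted_laplacian_square[OF x f] eigen[OF x] by simp
  moreover have "2 * (K - \<mu> * (N - 1) / N) * dot_grad f f x =
      2 * ((\<mu> * f x)\<^sup>2 / N - \<mu> * dot_grad f f x + K * dot_grad f f x)
      + \<mu> / N * (2 * (- \<mu> * (f x * f x) + dot_grad f f x))"
    using N by (simp add: field_simps power2_eq_square)
  ultimately show ?thesis by linarith
qed

end

section \<open>The maximum principle and unique continuation from a zero\<close>

lemma frechet_derivative_eq_sum:
  fixes f :: "real ^ 'n::finite \<Rightarrow> real"
  assumes "smooth_on S f" "x \<in> S"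
  shows "frechet_derivative f (at x) v = (\<Sum>j\<in>UNIV. v $ j * pderiv_at j f x)"
proof -
  have lin: "linear (frechet_derivative f (at x))"
    using smooth_on_imp_has_derivative[OF assms] by (rule has_derivative_linear)
  have "frechet_derivative f (at x) v = frechet_derivative f (at x) (\<Sum>j\<in>UNIV. v $ j *\<^sub>R axis j 1)"
    using basis_expansion[of v] by (simp add: scalar_mult_eq_scaleR)
  also have "\<dots> = (\<Sum>j\<in>UNIV. v $ j * pderiv_at j f x)"
    by (simp add: linear_sum[OF lin] linear_cmul[OF lin] pderiv_at_def)
  finally show ?thesis .
qed

text \<open>If the second derivative along a line were positive, the first one, which vanishes at the maximum,
  would be positive shortly after it, and the function would increase.\<close>

lemma second_derivative_at_max:
  fixes f :: "'a::real_normed_vector \<Rightarrow> real"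
  assumes S: "open S" "x \<in> S" and f: "smooth_on S f" and max: "\<And>y. y \<in> S \<Longrightarrow> f y \<le> f x"
  shows "frechet_derivative (\<lambda>z. frechet_derivative f (at z) v) (at x) v \<le> 0"
proof (rule ccontr)
  assume neg: "\<not> ?thesis"
  let ?Dv = "\<lambda>z. frechet_derivative f (at z) v"
  have line: "((\<lambda>t. h (x + t *\<^sub>R v)) has_real_derivative frechet_derivative h (at (x + t *\<^sub>R v)) v) (at t)"
    if "smooth_on S h" "x + t *\<^sub>R v \<in> S" for h :: "'a \<Rightarrow> real" and t
  proof -
    have fd: "(h has_derivative frechet_derivative h (at (x + t *\<^sub>R v))) (at (x + t *\<^sub>R v))"
      using that by (rule smooth_on_imp_has_derivative)
    have "((\<lambda>t. x + t *\<^sub>R v) has_derivative (\<lambda>s. s *\<^sub>R v)) (at t)"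
      by (auto intro!: derivative_eq_intros)
    from has_derivative_compose[OF this fd]
    show ?thesis
      by (simp add: has_field_derivative_def linear_cmul[OF has_derivative_linear[OF fd]] mult_commute_abs)
  qed
  obtain r where r: "r > 0" "ball x r \<subseteq> S" using S openE by blast
  define e where "e = r / (norm v + 1)"
  have nv: "norm v + 1 > 0" using norm_ge_zero[of v] by linarith
  have e: "e > 0" using r(1) nv by (simp add: e_def)
  have inS: "x + t *\<^sub>R v \<in> S" if "\<bar>t\<bar> < e" for t
  proof -
    have "\<bar>t\<bar> * norm v \<le> \<bar>t\<bar> * (norm v + 1)" by (simp add: mult_left_mono)
    also have "\<dots> < e * (norm v + 1)" using that nv by (rule mult_strict_right_mono)
    also have "\<dots> = r" using nv by (simp add: e_def)
    finally have "x + t *\<^sub>R v \<in> ball x r" by (simp add: dist_norm)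
    then show ?thesis using r(2) by blast
  qed
  have D1: "((\<lambda>t. f (x + t *\<^sub>R v)) has_real_derivative ?Dv (x + t *\<^sub>R v)) (at t)" if "\<bar>t\<bar> < e" for t
    by (rule line[OF f inS[OF that]])
  have D2: "((\<lambda>t. ?Dv (x + t *\<^sub>R v)) has_real_derivative frechet_derivative ?Dv (at (x + 0 *\<^sub>R v)) v) (at 0)"
    by (rule line[OF smooth_on_directional_derivative[OF f] inS]) (use e in simp)
  have crit: "?Dv (x + 0 *\<^sub>R v) = 0"
  proof (rule DERIV_local_max)
    show "((\<lambda>t. f (x + t *\<^sub>R v)) has_real_derivative ?Dv (x + 0 *\<^sub>R v)) (at 0)"
      by (rule D1) (use e in simp)
    show "0 < e" by (rule e)
    show "\<forall>y. \<bar>0 - y\<bar> < e \<longrightarrow> f (x + y *\<^sub>R v) \<le> f (x + 0 *\<^sub>R v)"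
      using max inS by simp
  qed
  have "frechet_derivative ?Dv (at (x + 0 *\<^sub>R v)) v > 0" using neg by simp
  from DERIV_pos_inc_right[OF D2 this] obtain d where d: "d > 0"
    "\<forall>h>0. h < d \<longrightarrow> ?Dv (x + 0 *\<^sub>R v) < ?Dv (x + (0 + h) *\<^sub>R v)" by blast
  define h where "h = min d e / 2"
  have h: "0 < h" "h < d" "h < e" using d(1) e by (auto simp: h_def min_def)
  have "\<exists>z>0. z < h \<and> f (x + h *\<^sub>R v) - f (x + 0 *\<^sub>R v) = (h - 0) * ?Dv (x + z *\<^sub>R v)"
    using h by (intro MVT2 D1) auto
  then obtain z where z: "0 < z" "z < h" "f (x + h *\<^sub>R v) - f x = h * ?Dv (x + z *\<^sub>R v)" by auto
  have "?Dv (x + z *\<^sub>R v) > 0" using d(2)[rule_format, of z] z h crit by simp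
  then have "f (x + h *\<^sub>R v) > f x" using z h mult_pos_pos[of h "?Dv (x + z *\<^sub>R v)"] by linarith
  moreover have "f (x + h *\<^sub>R v) \<le> f x" by (rule max[OF inS]) (use h in simp)
  ultimately show False by simp
qed

context local_metric
begin

text \<open>At a critical point the symbols and the drift drop out, and the Laplacian is the trace of the matrix
  of second partial derivatives against the inverse metric.\<close>

lemma weighted_laplacian_at_max:
  assumes x: "x \<in> S" and f: "smooth_on S f" and max: "\<And>y. y \<in> S \<Longrightarrow> f y \<le> f x"
  shows "weighted_laplacian G \<psi> f x \<le> 0"
proof -
  have "frechet_derivative f (at x) = (\<lambda>h. 0)"
    by (rule differential_zero_maxmin[OF x open_S smooth_on_imp_has_derivative[OF f x]]) (use max in blast)
  then have p: "pderiv_at k f x = 0" for k by (simp add: pderiv_at_def)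
  have "psd (\<lambda>i j. - pderiv_at i (pderiv_at j f) x)"
    unfolding psd_def
  proof (intro conjI allI)
    show "- pderiv_at i (pderiv_at j f) x = - pderiv_at j (pderiv_at i f) x" for i j
      by (simp only: pderiv_at_commute[OF open_S x f])
    fix v :: "'n \<Rightarrow> real"
    let ?v = "\<chi> i. v i"
    have D: "frechet_derivative f (at y) ?v = (\<Sum>j\<in>UNIV. v j * pderiv_at j f y)" if "y \<in> S" for y
      using frechet_derivative_eq_sum[OF f that, of ?v] by simp
    have "(\<Sum>i\<in>UNIV. \<Sum>j\<in>UNIV. v i * v j * pderiv_at i (pderiv_at j f) x) =
      (\<Sum>i\<in>UNIV. v i * pderiv_at i (\<lambda>y. \<Sum>j\<in>UNIV. v j * pderiv_at j f y) x)"
      using f by (simp add: pderiv_at_sum[of _ S, OF _ x] pderiv_at_mult[OF _ _ x] smooth_intros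
          pderiv_at_const sum_distrib_left mult.assoc)
    also have "\<dots> = (\<Sum>i\<in>UNIV. v i * pderiv_at i (\<lambda>y. frechet_derivative f (at y) ?v) x)"
    proof -
      have "pderiv_at i (\<lambda>y. \<Sum>j\<in>UNIV. v j * pderiv_at j f y) x =
          pderiv_at i (\<lambda>y. frechet_derivative f (at y) ?v) x" for i
        by (rule pderiv_at_cong[OF open_S x]) (intro smooth_intros f, rule D[symmetric])
      then show ?thesis by simp
    qed
    also have "\<dots> = frechet_derivative (\<lambda>y. frechet_derivative f (at y) ?v) (at x) ?v"
      using frechet_derivative_eq_sum[OF smooth_on_directional_derivative[OF f] x, of ?v ?v] by simp
    also have "\<dots> \<le> 0" by (rule second_derivative_at_max[OF open_S x f max])
    finally show "0 \<le> (\<Sum>i\<in>UNIV. \<Sum>j\<in>UNIV. v i * v j * - pderiv_at i (pderiv_at j f) x)"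
      by (simp add: sum_negf)
  qed
  from psd_trace_nonneg[OF psd_ginv[OF x] this]
  have "laplacian G f x \<le> 0" by (simp add: laplacian_def hessian_comp_def p sum_negf)
  then show ?thesis by (simp add: weighted_laplacian_eq[OF x] dot_grad_def p)
qed

lemma metric_inner_sym: "x \<in> S \<Longrightarrow> metric_inner G x v w = metric_inner G x w v"
proof -
  assume x: "x \<in> S"
  have "v \<bullet> (G x *v w) = (transpose (G x) *v v) \<bullet> w"
    by (simp only: dot_lmul_matrix[symmetric] transpose_matrix_vector)
  then show ?thesis by (simp add: metric_inner_def sym_G[OF x] inner_commute)
qed

lemma metric_inner_nonneg: "x \<in> S \<Longrightarrow> 0 \<le> metric_inner G x v v"
  using pos_G[of x v] by (cases "v = 0") (auto simp: metric_inner_def)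

lemma frechet_derivative_eq_metric_inner:
  assumes "smooth_on S f" "x \<in> S"
  shows "frechet_derivative f (at x) v = metric_inner G x v (gradient G f x)"
  using assms by (simp add: frechet_derivative_eq_sum metric_inner_gradient mult.commute)

text \<open>This is the Cauchy-Schwarz inequality for \<open>v\<close> and the gradient.\<close>

lemma frechet_derivative_sq_le:
  assumes f: "smooth_on S f" and x: "x \<in> S"
  shows "(frechet_derivative f (at x) v)\<^sup>2 \<le> metric_inner G x v v * dot_grad f f x"
proof (cases "v = 0")
  case True
  then show ?thesis
    by (simp add: frechet_derivative_eq_sum[OF f x] metric_inner_def)
next
  case False
  let ?U = "gradient G f x"
  define a where "a = metric_inner G x v v"
  define b where "b = metric_inner G x v ?U"
  have a: "a > 0" using pos_G[OF x False] by (simp add: a_def metric_inner_def)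
  define s where "s = b / a"
  have "0 \<le> metric_inner G x (?U - s *\<^sub>R v) (?U - s *\<^sub>R v)" by (rule metric_inner_nonneg[OF x])
  also have "\<dots> = metric_inner G x ?U ?U - s * metric_inner G x ?U v - s * b + s * s * a"
    by (simp add: a_def b_def metric_inner_def matrix_vector_mult_diff_distrib matrix_vector_mult_scaleR
        inner_diff_left inner_diff_right algebra_simps)
  also have "metric_inner G x ?U v = b" unfolding b_def by (rule metric_inner_sym[OF x])
  also have "metric_inner G x ?U ?U = dot_grad f f x" by (rule metric_inner_gradients[OF x])
  also have "dot_grad f f x - s * b - s * b + s * s * a = dot_grad f f x - b\<^sup>2 / a"
    using a by (simp add: s_def field_simps power2_eq_square)
  finally have "b\<^sup>2 / a \<le> dot_grad f f x" by simp
  then have "b\<^sup>2 \<le> a * dot_grad f f x" using a by (simp add: pos_divide_le_eq mult.commute)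
  then show ?thesis by (simp add: frechet_derivative_eq_metric_inner[OF f x] a_def b_def)
qed

lemma metric_inner_bounded:
  assumes "compact C" "C \<subseteq> S"
  obtains B where "B \<ge> 0" "\<And>y v. y \<in> C \<Longrightarrow> metric_inner G y v v \<le> B * (norm v)\<^sup>2"
proof -
  let ?F = "\<lambda>y. \<Sum>i\<in>UNIV. \<Sum>j\<in>UNIV. \<bar>G y $ i $ j\<bar>"
  have "continuous_on C ?F"
    by (intro continuous_on_sum continuous_on_rabs
        smooth_on_imp_continuous_on[OF smooth_on_subset[OF smooth_G_comp assms(2)]])
  then have "bounded (?F ` C)" using assms(1) by (intro compact_imp_bounded compact_continuous_image)
  then obtain B where B: "\<And>y. y \<in> C \<Longrightarrow> \<bar>?F y\<bar> \<le> B" unfolding bounded_iff by auto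
  have "metric_inner G y v v \<le> max B 0 * (norm v)\<^sup>2" if y: "y \<in> C" for y v
  proof -
    have "metric_inner G y v v = (\<Sum>i\<in>UNIV. \<Sum>j\<in>UNIV. v $ i * G y $ i $ j * v $ j)"
      by (simp add: metric_inner_def inner_vec_def matrix_vector_mult_def sum_distrib_left mult.assoc)
    also have "\<dots> \<le> (\<Sum>i\<in>UNIV. \<Sum>j\<in>UNIV. \<bar>G y $ i $ j\<bar> * (norm v)\<^sup>2)"
    proof (intro sum_mono)
      fix i j
      have "v $ i * G y $ i $ j * v $ j \<le> \<bar>G y $ i $ j\<bar> * (\<bar>v $ i\<bar> * \<bar>v $ j\<bar>)"
        using abs_ge_self[of "v $ i * G y $ i $ j * v $ j"] by (simp add: abs_mult mult_ac)
      also have "\<dots> \<le> \<bar>G y $ i $ j\<bar> * (norm v * norm v)"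
        by (intro mult_left_mono mult_mono component_le_norm_cart) auto
      finally show "v $ i * G y $ i $ j * v $ j \<le> \<bar>G y $ i $ j\<bar> * (norm v)\<^sup>2"
        by (simp add: power2_eq_square)
    qed
    also have "\<dots> = ?F y * (norm v)\<^sup>2" by (simp add: sum_distrib_right)
    also have "\<dots> \<le> max B 0 * (norm v)\<^sup>2" using B[OF y] by (intro mult_right_mono) auto
    finally show ?thesis .
  qed
  then show ?thesis using that[of "max B 0"] by auto
qed

text \<open>Where the gradient of \<open>f\<close> is controlled by \<open>f\<close>, the logarithm of \<open>\<bar>f\<bar>\<close> is Lipschitz and
  cannot tend to minus infinity: on a small ball around a zero, the mean value inequality bounds the
  maximum of \<open>\<bar>f\<bar>\<close> by half of itself.\<close>

lemma zero_near_zero: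
  assumes f: "smooth_on S f" and C: "C \<ge> 0" and grad: "\<And>y. y \<in> S \<Longrightarrow> dot_grad f f y \<le> C * (f y)\<^sup>2"
    and x: "x \<in> S" "f x = 0"
  shows "\<exists>e>0. ball x e \<subseteq> S \<and> (\<forall>y\<in>ball x e. f y = 0)"
proof -
  obtain r where r: "r > 0" "cball x r \<subseteq> S" using open_S x(1) open_contains_cball by blast
  obtain B where B: "B \<ge> 0" "\<And>y v. y \<in> cball x r \<Longrightarrow> metric_inner G y v v \<le> B * (norm v)\<^sup>2"
    using metric_inner_bounded[OF compact_cball r(2)] by blast
  define E where "E = sqrt (B * C)"
  have E: "E \<ge> 0" by (simp add: E_def B(1) C)
  have D: "\<bar>frechet_derivative f (at y) v\<bar> \<le> E * norm v * \<bar>f y\<bar>" if y: "y \<in> cball x r" for y v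
  proof -
    have yS: "y \<in> S" using y r(2) by blast
    have "(frechet_derivative f (at y) v)\<^sup>2 \<le> metric_inner G y v v * dot_grad f f y"
      by (rule frechet_derivative_sq_le[OF f yS])
    also have "\<dots> \<le> (B * (norm v)\<^sup>2) * (C * (f y)\<^sup>2)"
      using B(1) by (intro mult_mono B(2)[OF y] grad[OF yS] dot_grad_nonneg[OF yS]) auto
    also have "\<dots> = (E * norm v * \<bar>f y\<bar>)\<^sup>2"
      using B(1) C by (simp add: E_def power_mult_distrib mult_ac)
    finally have "\<bar>frechet_derivative f (at y) v\<bar>\<^sup>2 \<le> (E * norm v * \<bar>f y\<bar>)\<^sup>2" by simp
    then show ?thesis by (rule power2_le_imp_le) (simp add: E)
  qed
  \<comment> \<open>The radius is chosen so that the oscillation \<open>e E \<bar>f z\<bar>\<close> is at most half the maximum \<open>\<bar>f z\<bar>\<close>.\<close>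
  define e where "e = min r (1 / (2 * (E + 1)))"
  have e: "e > 0" "e \<le> r" using r(1) E by (auto simp: e_def)
  have eE: "e * E \<le> 1 / 2"
  proof -
    have "e * E \<le> 1 / (2 * (E + 1)) * (E + 1)"
      using E e(1) by (intro mult_mono) (auto simp: e_def)
    also have "\<dots> = 1 / 2" using E by (simp add: field_simps)
    finally show ?thesis .
  qed
  have sub: "cball x e \<subseteq> cball x r" using e(2) by auto
  have "continuous_on (cball x e) (\<lambda>y. \<bar>f y\<bar>)"
    by (intro continuous_on_rabs smooth_on_imp_continuous_on[OF smooth_on_subset[OF f]] subset_trans[OF sub r(2)])
  then obtain z where z: "z \<in> cball x e" "\<And>y. y \<in> cball x e \<Longrightarrow> \<bar>f y\<bar> \<le> \<bar>f z\<bar>"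
    using continuous_attains_sup[of "cball x e" "\<lambda>y. \<bar>f y\<bar>"] e(1) by auto
  have "norm (f z - f x) \<le> (E * \<bar>f z\<bar>) * norm (z - x)"
  proof (rule differentiable_bound)
    show "convex (cball x e)" by simp
    fix y assume y: "y \<in> cball x e"
    then have yr: "y \<in> cball x r" using sub by blast
    then have "y \<in> S" using r(2) by blast
    then have der: "(f has_derivative frechet_derivative f (at y)) (at y)"
      by (rule smooth_on_imp_has_derivative[OF f])
    then show "(f has_derivative frechet_derivative f (at y)) (at y within cball x e)"
      by (rule has_derivative_at_withinI)
    show "onorm (frechet_derivative f (at y)) \<le> E * \<bar>f z\<bar>"
    proof (rule onorm_bound)
      show "0 \<le> E * \<bar>f z\<bar>" using E by simp
      fix v
      have "\<bar>frechet_derivative f (at y) v\<bar> \<le> E * norm v * \<bar>f y\<bar>" by (rule D[OF yr])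
      also have "\<dots> \<le> E * norm v * \<bar>f z\<bar>" using z(2)[OF y] E by (intro mult_left_mono) auto
      finally show "norm (frechet_derivative f (at y) v) \<le> E * \<bar>f z\<bar> * norm v"
        by (simp add: mult_ac)
    qed
  qed (use z e in auto)
  also have "\<dots> \<le> (E * \<bar>f z\<bar>) * e"
    using z(1) E by (intro mult_left_mono) (auto simp: dist_norm norm_minus_commute)
  also have "\<dots> = (e * E) * \<bar>f z\<bar>" by simp
  also have "\<dots> \<le> 1 / 2 * \<bar>f z\<bar>" using eE by (intro mult_right_mono) auto
  finally have "f z = 0" using x(2) by simp
  then have "\<forall>y\<in>ball x e. f y = 0" using z(2) by fastforce
  moreover have "ball x e \<subseteq> S" using sub r(2) ball_subset_cball by blast
  ultimately show ?thesis using e(1) by blast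
qed

end

section \<open>Functions on the manifold\<close>

locale riemannian_manifold =
  fixes X :: "'a topology" and A :: "('a, 'n::finite) chart set"
    and g :: "('a, 'n) chart \<Rightarrow> real ^ 'n \<Rightarrow> real ^ 'n ^ 'n"
  assumes manifold: "smooth_manifold X A" and metric: "riemannian_metric A g"
begin

lemma chart: assumes "c \<in> A"
  shows open_domain: "openin X (fst c)" and open_chart_image: "open (chart_image c)"
    and chart_homeo: "homeomorphic_map (subtopology X (fst c)) (top_of_set (chart_image c)) (snd c)"
  using manifold assms by (auto simp: smooth_manifold_def is_chart_def)

lemma cover: assumes "p \<in> topspace X" obtains c where "c \<in> A" "p \<in> fst c"
  using manifold assms unfolding smooth_manifold_def by blast

lemma domain_subset: "c \<in> A \<Longrightarrow> fst c \<subseteq> topspace X"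
  by (rule openin_subset[OF open_domain])

lemma chart_inj: assumes "c \<in> A" shows "inj_on (snd c) (fst c)"
  using chart_homeo[OF assms] domain_subset[OF assms]
  by (simp add: homeomorphic_eq_everything_map Int_absorb1)

lemma chart_inv_chart: "c \<in> A \<Longrightarrow> p \<in> fst c \<Longrightarrow> chart_inv c (snd c p) = p"
  by (simp add: chart_inv_def chart_inj)

lemma chart_mem: "p \<in> fst c \<Longrightarrow> snd c p \<in> chart_image c"
  by (simp add: chart_image_def)

lemma chart_inv_mem: "y \<in> chart_image c \<Longrightarrow> chart_inv c y \<in> fst c"
  unfolding chart_inv_def chart_image_def by (rule inv_into_into)

lemma chart_chart_inv: "y \<in> chart_image c \<Longrightarrow> snd c (chart_inv c y) = y"
  unfolding chart_inv_def chart_image_def by (rule f_inv_into_f)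

lemma local_metric: "c \<in> A \<Longrightarrow> local_metric (chart_image c) (g c)"
proof -
  assume c: "c \<in> A"
  from metric[unfolded riemannian_metric_def, THEN conjunct1, rule_format, OF c]
  show ?thesis by unfold_locales (use open_chart_image[OF c] in auto)
qed

lemma metric_transformation:
  assumes "c \<in> A" "d \<in> A" "p \<in> fst c" "p \<in> fst d"
  shows "metric_inner (g c) (snd c p) v w = metric_inner (g d) (snd d p)
    (frechet_derivative (transition c d) (at (snd c p)) v) (frechet_derivative (transition c d) (at (snd c p)) w)"
  unfolding metric_inner_def
  by (rule metric[unfolded riemannian_metric_def, THEN conjunct2, rule_format]) (use assms in auto)

lemma openin_chart_preimage:
  assumes c: "c \<in> A" and U: "open U"
  shows "openin X {p \<in> fst c. snd c p \<in> U}"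
proof -
  have "continuous_map (subtopology X (fst c)) (top_of_set (chart_image c)) (snd c)"
    by (rule homeomorphic_imp_continuous_map[OF chart_homeo[OF c]])
  then have "continuous_map (subtopology X (fst c)) euclidean (snd c)"
    by (simp add: continuous_map_in_subtopology)
  then have "openin (subtopology X (fst c)) {p \<in> topspace (subtopology X (fst c)). snd c p \<in> U}"
    using U by (intro openin_continuous_map_preimage) auto
  also have "{p \<in> topspace (subtopology X (fst c)). snd c p \<in> U} = {p \<in> fst c. snd c p \<in> U}"
    using domain_subset[OF c] by auto
  finally show ?thesis by (rule openin_trans_full[OF _ open_domain[OF c]])
qed

lemma open_chart_overlap:
  assumes c: "c \<in> A" and d: "d \<in> A"
  shows "open (snd c ` (fst c \<inter> fst d))"
proof -
  have "open_map (subtopology X (fst c)) (top_of_set (chart_image c)) (snd c)"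
    using chart_homeo[OF c] by (simp add: homeomorphic_eq_everything_map)
  moreover have "openin (subtopology X (fst c)) (fst c \<inter> fst d)"
    using open_domain[OF d] by (rule openin_subtopology_Int2)
  ultimately have "openin (top_of_set (chart_image c)) (snd c ` (fst c \<inter> fst d))"
    unfolding open_map_def by blast
  then show ?thesis by (rule openin_open_trans[OF _ open_chart_image[OF c]])
qed

lemma continuous_map_from_charts:
  fixes F :: "'a \<Rightarrow> real"
  assumes F: "\<And>c. c \<in> A \<Longrightarrow> continuous_on (chart_image c) (F \<circ> chart_inv c)"
  shows "continuous_map X euclideanreal F"
  unfolding continuous_map_def
proof (intro conjI allI impI)
  fix T :: "real set"
  assume "openin euclideanreal T"
  then have T: "open T" by simp
  let ?V = "\<lambda>c. (F \<circ> chart_inv c) -` T \<inter> chart_image c"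
  have mem: "snd c p \<in> ?V c \<longleftrightarrow> F p \<in> T" if "c \<in> A" "p \<in> fst c" for c p
    using that by (simp add: chart_inv_chart chart_mem)
  have "{p \<in> topspace X. F p \<in> T} = (\<Union>c\<in>A. {p \<in> fst c. snd c p \<in> ?V c})"
  proof (intro set_eqI iffI)
    fix p assume "p \<in> {p \<in> topspace X. F p \<in> T}"
    moreover then obtain c where "c \<in> A" "p \<in> fst c" using cover by blast
    ultimately show "p \<in> (\<Union>c\<in>A. {p \<in> fst c. snd c p \<in> ?V c})" using mem by blast
  next
    fix p assume "p \<in> (\<Union>c\<in>A. {p \<in> fst c. snd c p \<in> ?V c})"
    then obtain c where c: "c \<in> A" "p \<in> fst c" "snd c p \<in> ?V c" by blast
    then have "F p \<in> T" using mem[OF c(1,2)] by blast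
    then show "p \<in> {p \<in> topspace X. F p \<in> T}" using c domain_subset by blast
  qed
  moreover have "openin X {p \<in> fst c. snd c p \<in> ?V c}" if "c \<in> A" for c
  proof (rule openin_chart_preimage[OF that])
    show "open (?V c)"
      using F[OF that] T unfolding continuous_on_open_vimage[OF open_chart_image[OF that]] by blast
  qed
  ultimately show "openin X {p \<in> topspace X. F p \<in> T}" by auto
qed auto

lemma smooth_funD: "smooth_fun A u \<Longrightarrow> c \<in> A \<Longrightarrow> smooth_on (chart_image c) (u \<circ> chart_inv c)"
  by (simp add: smooth_fun_def)

lemma smooth_fun_continuous: "smooth_fun A u \<Longrightarrow> continuous_map X euclideanreal u"
  by (rule continuous_map_from_charts) (rule smooth_on_imp_continuous_on[OF smooth_funD])

definition grad_sq :: "('a, 'n) chart \<Rightarrow> ('a \<Rightarrow> real) \<Rightarrow> 'a \<Rightarrow> real" where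
  "grad_sq c u p = local_metric.dot_grad (g c) (u \<circ> chart_inv c) (u \<circ> chart_inv c) (snd c p)"

text \<open>The differential of a transition map is an isometry for the metrics in the two charts, hence invertible,
  and it maps one coordinate expression of the gradient to the other.\<close>

lemma grad_sq_chart_independent:
  assumes c: "c \<in> A" and d: "d \<in> A" and p: "p \<in> fst c" "p \<in> fst d" and u: "smooth_fun A u"
  shows "grad_sq c u p = grad_sq d u p"
proof -
  interpret C: local_metric "chart_image c" "g c" by (rule local_metric[OF c])
  interpret D: local_metric "chart_image d" "g d" by (rule local_metric[OF d])
  let ?x = "snd c p" and ?y = "snd d p"
  let ?uc = "u \<circ> chart_inv c" and ?ud = "u \<circ> chart_inv d"
  let ?W = "snd c ` (fst c \<inter> fst d)"
  let ?J = "frechet_derivative (transition c d) (at ?x)"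
  let ?U = "gradient (g c) ?uc ?x" and ?V = "gradient (g d) ?ud ?y"
  have x: "?x \<in> chart_image c" and y: "?y \<in> chart_image d" and xW: "?x \<in> ?W"
    using p by (auto simp: chart_mem)
  have tr: "transition c d ?x = ?y" by (simp add: transition_def chart_inv_chart[OF c p(1)])
  have "smooth_on ?W (transition c d)" using manifold c d by (simp add: smooth_manifold_def)
  then have J: "(transition c d has_derivative ?J) (at ?x)"
    using xW by (rule smooth_on_imp_has_derivative)
  then have lin: "linear ?J" by (rule has_derivative_linear)
  have iso: "metric_inner (g c) ?x v w = metric_inner (g d) ?y (?J v) (?J w)" for v w
    by (rule metric_transformation[OF c d p])
  have chain: "frechet_derivative ?uc (at ?x) v = frechet_derivative ?ud (at ?y) (?J v)" for v
  proof -
    have "(?ud has_derivative frechet_derivative ?ud (at ?y)) (at (transition c d ?x))"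
      unfolding tr using smooth_funD[OF u d] y by (rule smooth_on_imp_has_derivative)
    from has_derivative_compose[OF J this]
    have "((\<lambda>z. ?ud (transition c d z)) has_derivative (\<lambda>v. frechet_derivative ?ud (at ?y) (?J v))) (at ?x)" .
    then have "(?uc has_derivative (\<lambda>v. frechet_derivative ?ud (at ?y) (?J v))) (at ?x)"
      by (rule has_derivative_transform_within_open[OF _ open_chart_overlap[OF c d] xW])
        (auto simp: transition_def chart_inv_chart[OF c] chart_inv_chart[OF d])
    from fun_cong[OF frechet_derivative_at[OF this], of v] show ?thesis by (rule sym)
  qed
  have "inj ?J"
    unfolding linear_injective_0[OF lin]
  proof (intro allI impI)
    fix v assume "?J v = 0"
    then have "metric_inner (g c) ?x v v = 0" unfolding iso by (simp add: metric_inner_def)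
    then show "v = 0" using C.pos_G[OF x, of v] by (fastforce simp: metric_inner_def)
  qed
  then have surj: "surj ?J" by (rule linear_inj_imp_surj[OF lin])
  have pull: "metric_inner (g d) ?y (?J v) (?J ?U) = metric_inner (g d) ?y (?J v) ?V" for v
  proof -
    have "metric_inner (g d) ?y (?J v) (?J ?U) = metric_inner (g c) ?x v ?U" by (rule iso[symmetric])
    also have "\<dots> = frechet_derivative ?uc (at ?x) v"
      by (rule C.frechet_derivative_eq_metric_inner[OF smooth_funD[OF u c] x, symmetric])
    also have "\<dots> = frechet_derivative ?ud (at ?y) (?J v)" by (rule chain)
    also have "\<dots> = metric_inner (g d) ?y (?J v) ?V"
      by (rule D.frechet_derivative_eq_metric_inner[OF smooth_funD[OF u d] y])
    finally show ?thesis .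
  qed
  have "metric_inner (g d) ?y w (?J ?U) = metric_inner (g d) ?y w ?V" for w
  proof -
    obtain v where "w = ?J v" using surj by (rule surjE)
    then show ?thesis using pull[of v] by simp
  qed
  from this[of "?J ?U - ?V"] have "(?J ?U - ?V) \<bullet> (g d ?y *v (?J ?U - ?V)) = 0"
    by (simp add: metric_inner_def matrix_vector_mult_diff_distrib inner_diff_right)
  then have "?J ?U = ?V" using D.pos_G[OF y, of "?J ?U - ?V"] by fastforce
  then show ?thesis
    unfolding grad_sq_def C.metric_inner_gradients[OF x, symmetric] D.metric_inner_gradients[OF y, symmetric]
    by (simp add: iso)
qed

definition chart_at :: "'a \<Rightarrow> ('a, 'n) chart" where
  "chart_at p = (SOME c. c \<in> A \<and> p \<in> fst c)"

lemma chart_at: assumes "p \<in> topspace X" shows "chart_at p \<in> A" "p \<in> fst (chart_at p)"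
proof -
  have "\<exists>c. c \<in> A \<and> p \<in> fst c" using cover[OF assms] by blast
  from someI_ex[OF this] show "chart_at p \<in> A" "p \<in> fst (chart_at p)"
    unfolding chart_at_def by blast+
qed

lemma weighted_laplacian_at_max:
  assumes c: "c \<in> A" "p \<in> fst c" and F: "smooth_on (chart_image c) (F \<circ> chart_inv c)"
    and max: "\<And>q. q \<in> topspace X \<Longrightarrow> F q \<le> F p"
  shows "weighted_laplacian (g c) \<psi> (F \<circ> chart_inv c) (snd c p) \<le> 0"
proof (rule local_metric.weighted_laplacian_at_max[OF local_metric[OF c(1)] chart_mem[OF c(2)] F])
  fix y assume "y \<in> chart_image c"
  then have "chart_inv c y \<in> topspace X" using chart_inv_mem domain_subset[OF c(1)] by blast
  then show "(F \<circ> chart_inv c) y \<le> (F \<circ> chart_inv c) (snd c p)"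
    using max by (simp add: chart_inv_chart[OF c])
qed

end

section \<open>The eigenvalue estimate\<close>

locale eigenfunction_on_compact_manifold = riemannian_manifold +
  fixes \<psi> u :: "'a \<Rightarrow> real" and \<mu> K N :: real
  assumes compact: "compact_space X" and connected: "connected_space X"
    and \<psi>: "smooth_fun A \<psi>" and N: "N < 0"
    and ric: "weighted_ricci_ge A g \<psi> N K"
    and u: "smooth_fun A u" and nonzero: "\<exists>p\<in>topspace X. u p \<noteq> 0"
    and eigen: "\<And>c p. c \<in> A \<Longrightarrow> p \<in> fst c \<Longrightarrow>
       - weighted_laplacian (g c) (\<psi> \<circ> chart_inv c) (u \<circ> chart_inv c) (snd c p) = \<mu> * u p"
    and \<mu>_nonzero: "\<mu> \<noteq> 0"
begin

lemma eigen_chart: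
  "c \<in> A \<Longrightarrow> y \<in> chart_image c \<Longrightarrow>
    weighted_laplacian (g c) (\<psi> \<circ> chart_inv c) (u \<circ> chart_inv c) y = - \<mu> * (u \<circ> chart_inv c) y"
  using eigen[of c "chart_inv c y"] by (simp add: chart_inv_mem chart_chart_inv)

lemma attains_max:
  fixes F :: "'a \<Rightarrow> real"
  assumes "continuous_map X euclideanreal F"
  obtains p c where "p \<in> topspace X" "\<And>q. q \<in> topspace X \<Longrightarrow> F q \<le> F p" "c \<in> A" "p \<in> fst c"
proof -
  have "compactin euclideanreal (F ` topspace X)"
    using compact assms unfolding compact_space_def by (rule image_compactin)
  then have "compact (F ` topspace X)" by simp
  moreover have "F ` topspace X \<noteq> {}" using nonzero by blast
  ultimately obtain s where s: "s \<in> F ` topspace X" "\<forall>t\<in>F ` topspace X. t \<le> s"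
    using compact_attains_sup by blast
  then obtain p where p: "p \<in> topspace X" "s = F p" by blast
  obtain c where c: "c \<in> A" "p \<in> fst c" using cover[OF p(1)] .
  show ?thesis by (rule that[OF p(1) _ c]) (use s(2) p(2) in auto)
qed

text \<open>If \<open>\<mu> < 0\<close>, then \<open>L u\<^sup>2 = 2 \<bar>\<nabla>u\<bar>\<^sup>2 - 2 \<mu> u\<^sup>2\<close> is positive wherever \<open>u\<close> does not vanish, which
  is impossible at a maximum of \<open>u\<^sup>2\<close>.\<close>

lemma eigenvalue_pos: "\<mu> > 0"
proof (rule ccontr)
  assume "\<not> ?thesis"
  then have neg: "\<mu> < 0" using \<mu>_nonzero by simp
  let ?F = "\<lambda>p. u p * u p"
  have "continuous_map X euclideanreal ?F"
    using smooth_fun_continuous[OF u] by (intro continuous_map_real_mult)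
  then obtain p c where p: "p \<in> topspace X" "\<And>q. q \<in> topspace X \<Longrightarrow> ?F q \<le> ?F p" and c: "c \<in> A" "p \<in> fst c"
    using attains_max by blast
  interpret C: local_metric "chart_image c" "g c" by (rule local_metric[OF c(1)])
  note uc = smooth_funD[OF u c(1)] and x = chart_mem[OF c(2)]
  have e: "?F \<circ> chart_inv c = (\<lambda>y. (u \<circ> chart_inv c) y * (u \<circ> chart_inv c) y)" by (simp add: fun_eq_iff)
  have "weighted_laplacian (g c) (\<psi> \<circ> chart_inv c) (?F \<circ> chart_inv c) (snd c p) \<le> 0"
    by (rule weighted_laplacian_at_max[where F = ?F, OF c _ p(2)]) (unfold e, rule smooth_on_mult[OF C.open_S uc uc])
  then have "2 * (u p * (- \<mu> * u p) + grad_sq c u p) \<le> 0"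
    unfolding e C.weighted_laplacian_square[OF x uc] eigen_chart[OF c(1) x]
    by (simp add: grad_sq_def chart_inv_chart[OF c])
  moreover have "0 \<le> grad_sq c u p" unfolding grad_sq_def by (rule C.dot_grad_nonneg[OF x])
  ultimately have "- \<mu> * ?F p \<le> 0" by (simp add: mult_ac)
  then have "?F p \<le> 0" using neg by (simp add: mult_le_0_iff zero_le_mult_iff)
  then have le: "u q * u q \<le> 0" if "q \<in> topspace X" for q
    using p(2)[OF that] by linarith
  have "u q = 0" if "q \<in> topspace X" for q
    using le[OF that] by (auto simp: mult_le_0_iff)
  then show False using nonzero by blast
qed

text \<open>By the maximum principle for \<open>u\<close> and \<open>- u\<close>, the function \<open>u\<close> is nonnegative at its maximum and
  nonpositive at its minimum, and its image is connected.\<close>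

lemma has_zero: "\<exists>p\<in>topspace X. u p = 0"
proof -
  have cu: "continuous_map X euclideanreal u" by (rule smooth_fun_continuous[OF u])
  obtain p c where p: "p \<in> topspace X" "\<And>q. q \<in> topspace X \<Longrightarrow> u q \<le> u p" and c: "c \<in> A" "p \<in> fst c"
    using attains_max[OF cu] by blast
  have "- \<mu> * u p \<le> 0"
    using weighted_laplacian_at_max[OF c smooth_funD[OF u c(1)] p(2), of "\<psi> \<circ> chart_inv c"] eigen[OF c] by simp
  then have up: "u p \<ge> 0" using eigenvalue_pos by (simp add: zero_le_mult_iff)
  \<comment> \<open>The function \<open>- u\<close>, written in the form whose weighted Laplacian is known.\<close>
  have "continuous_map X euclideanreal (\<lambda>p. u p + (-2) * u p)"
    by (intro continuous_map_add continuous_map_real_mult cu) simp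
  then obtain q d where q: "q \<in> topspace X" "\<And>r. r \<in> topspace X \<Longrightarrow> u r + (-2) * u r \<le> u q + (-2) * u q"
    and d: "d \<in> A" "q \<in> fst d"
    using attains_max by blast
  interpret D: local_metric "chart_image d" "g d" by (rule local_metric[OF d(1)])
  note ud = smooth_funD[OF u d(1)] and y = chart_mem[OF d(2)]
  have e: "(\<lambda>p. u p + (-2) * u p) \<circ> chart_inv d = (\<lambda>y. (u \<circ> chart_inv d) y + (-2) * (u \<circ> chart_inv d) y)"
    by (simp add: fun_eq_iff)
  have "weighted_laplacian (g d) (\<psi> \<circ> chart_inv d) ((\<lambda>p. u p + (-2) * u p) \<circ> chart_inv d) (snd d q) \<le> 0"
    by (rule weighted_laplacian_at_max[where F = "\<lambda>p. u p + (-2) * u p", OF d _ q(2)])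
      (unfold e, intro smooth_on_add[OF D.open_S] smooth_on_mult[OF D.open_S] smooth_on_const ud)
  then have "\<mu> * u q \<le> 0"
    unfolding e D.weighted_laplacian_add_scale[OF y ud ud] using eigen[OF d] by simp
  then have uq: "u q \<le> 0" using eigenvalue_pos by (simp add: mult_le_0_iff)
  have "connectedin euclideanreal (u ` topspace X)"
    using connected by (intro connectedin_continuous_map_image[OF cu]) (simp add: connectedin_topspace)
  then have "connected (u ` topspace X)" by simp
  then have "0 \<in> u ` topspace X"
    using up uq p(1) q(1) unfolding connected_iff_interval by blast
  then show ?thesis by auto
qed

text \<open>The function \<open>F\<close> below is \<open>P = \<bar>\<nabla>u\<bar>\<^sup>2 + (\<mu> / N) u\<^sup>2\<close>. Its gradient term vanishes at a maximum by
  subharmonicity, and the other term is nonpositive.\<close>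

lemma gradient_estimate:
  assumes small: "\<mu> < K * N / (N - 1)" and c: "c \<in> A" "p \<in> fst c"
  shows "grad_sq c u p \<le> - \<mu> / N * (u p)\<^sup>2"
proof -
  define F where "F p = grad_sq (chart_at p) u p + \<mu> / N * (u p * u p)" for p
  have F_chart: "F p = grad_sq c u p + \<mu> / N * (u p * u p)" if "c \<in> A" "p \<in> fst c" for c p
  proof -
    have "p \<in> topspace X" using that domain_subset by blast
    then show ?thesis
      unfolding F_def using grad_sq_chart_independent[OF chart_at(1) that(1) chart_at(2) that(2) u] by simp
  qed
  let ?P = "\<lambda>c y. local_metric.dot_grad (g c) (u \<circ> chart_inv c) (u \<circ> chart_inv c) y
    + \<mu> / N * ((u \<circ> chart_inv c) y * (u \<circ> chart_inv c) y)"
  have F_local: "?P c y = (F \<circ> chart_inv c) y" if "c \<in> A" "y \<in> chart_image c" for c y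
    using F_chart[OF that(1) chart_inv_mem[OF that(2)]] that by (simp add: grad_sq_def chart_chart_inv)
  have P_smooth: "smooth_on (chart_image c) (?P c)" if "c \<in> A" for c
  proof -
    interpret C: local_metric "chart_image c" "g c" by (rule local_metric[OF that])
    note uc = smooth_funD[OF u that]
    show ?thesis
      by (intro smooth_on_add[OF C.open_S] smooth_on_mult[OF C.open_S] smooth_on_const
          C.smooth_dot_grad uc)
  qed
  have F_smooth: "smooth_on (chart_image c) (F \<circ> chart_inv c)" if "c \<in> A" for c
    by (rule smooth_on_cong[OF open_chart_image[OF that] F_local[OF that] P_smooth[OF that]])
  have "continuous_map X euclideanreal F"
    by (rule continuous_map_from_charts) (rule smooth_on_imp_continuous_on[OF F_smooth])
  then obtain m d where m: "m \<in> topspace X" "\<And>q. q \<in> topspace X \<Longrightarrow> F q \<le> F m" and d: "d \<in> A" "m \<in> fst d"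
    using attains_max by blast
  interpret D: local_metric "chart_image d" "g d" by (rule local_metric[OF d(1)])
  let ?\<psi> = "\<psi> \<circ> chart_inv d"
  note ud = smooth_funD[OF u d(1)] and y = chart_mem[OF d(2)]
  have ricd: "K * metric_inner (g d) (snd d m) v v \<le> weighted_ricci N (g d) ?\<psi> (snd d m) v" for v
    using ric d unfolding weighted_ricci_ge_def by blast
  have "2 * (K - \<mu> * (N - 1) / N) * grad_sq d u m \<le> weighted_laplacian (g d) ?\<psi> (?P d) (snd d m)"
    unfolding grad_sq_def
    by (rule D.eigenfunction_subharmonic[OF y ud smooth_funD[OF \<psi> d(1)] N ricd]) (rule eigen_chart[OF d(1)])
  also have "\<dots> \<le> 0"
  proof (rule D.weighted_laplacian_at_max[OF y P_smooth[OF d(1)]])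
    fix z assume z: "z \<in> chart_image d"
    then have "chart_inv d z \<in> topspace X" using chart_inv_mem domain_subset[OF d(1)] by blast
    then have "F (chart_inv d z) \<le> F m" by (rule m(2))
    then show "?P d z \<le> ?P d (snd d m)"
      unfolding F_local[OF d(1) z] F_local[OF d(1) y] by (simp add: chart_inv_chart[OF d])
  qed
  finally have le: "2 * (K - \<mu> * (N - 1) / N) * grad_sq d u m \<le> 0" .
  have "0 < K - \<mu> * (N - 1) / N"
    using small N by (simp add: field_simps)
  then have "grad_sq d u m \<le> 0" using le by (simp add: mult_le_0_iff)
  moreover have "\<mu> / N * (u m * u m) \<le> 0"
    using eigenvalue_pos N by (intro mult_nonpos_nonneg) (auto simp: divide_le_0_iff)
  ultimately have "F m \<le> 0" using F_chart[OF d] by simp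
  moreover have "F p \<le> F m" using c domain_subset by (intro m(2)) blast
  ultimately show ?thesis using F_chart[OF c] by (simp add: power2_eq_square)
qed

text \<open>Otherwise the gradient estimate makes the zero set open, so \<open>u\<close> would vanish on the whole connected
  manifold.\<close>

lemma eigenvalue_ge: "K * N / (N - 1) \<le> \<mu>"
proof (rule ccontr)
  assume "\<not> ?thesis"
  then have small: "\<mu> < K * N / (N - 1)" by simp
  define Z where "Z = {p \<in> topspace X. u p = 0}"
  have "closedin X {p \<in> topspace X. u p \<in> {0}}"
    by (rule closedin_continuous_map_preimage[OF smooth_fun_continuous[OF u]]) simp
  then have closed: "closedin X Z" by (simp add: Z_def)
  have "openin X Z"
  proof (subst openin_subopen, intro ballI)
    fix p assume "p \<in> Z"
    then have p: "p \<in> topspace X" "u p = 0" by (auto simp: Z_def)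
    obtain c where c: "c \<in> A" "p \<in> fst c" using cover[OF p(1)] by blast
    interpret C: local_metric "chart_image c" "g c" by (rule local_metric[OF c(1)])
    have "\<exists>e>0. ball (snd c p) e \<subseteq> chart_image c \<and> (\<forall>y\<in>ball (snd c p) e. (u \<circ> chart_inv c) y = 0)"
    proof (rule C.zero_near_zero[OF smooth_funD[OF u c(1)]])
      show "0 \<le> - \<mu> / N" using eigenvalue_pos N by (simp add: divide_nonneg_neg divide_nonpos_neg)
      show "C.dot_grad (u \<circ> chart_inv c) (u \<circ> chart_inv c) y \<le> - \<mu> / N * ((u \<circ> chart_inv c) y)\<^sup>2"
        if "y \<in> chart_image c" for y
        using gradient_estimate[OF small c(1) chart_inv_mem[OF that]] that
        by (simp add: grad_sq_def chart_chart_inv)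
    qed (use chart_mem[OF c(2)] p(2) in \<open>auto simp: chart_inv_chart[OF c]\<close>)
    then obtain e where e: "e > 0" "\<forall>y\<in>ball (snd c p) e. (u \<circ> chart_inv c) y = 0" by blast
    let ?T = "{q \<in> fst c. snd c q \<in> ball (snd c p) e}"
    have "openin X ?T" by (rule openin_chart_preimage[OF c(1) open_ball])
    moreover have "p \<in> ?T" using c e(1) by simp
    moreover have "?T \<subseteq> Z"
    proof
      fix q assume q: "q \<in> ?T"
      then have "(u \<circ> chart_inv c) (snd c q) = 0" using e(2) by blast
      then show "q \<in> Z" using q domain_subset[OF c(1)] by (auto simp: Z_def chart_inv_chart[OF c(1)])
    qed
    ultimately show "\<exists>T. openin X T \<and> p \<in> T \<and> T \<subseteq> Z" by blast
  qed
  then have "Z = {} \<or> Z = topspace X"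
    using closed connected unfolding connected_space_clopen_in by blast
  then show False using has_zero nonzero by (auto simp: Z_def)
qed

end

theorem corollary4p2:
  fixes X :: "'a topology"
    and A :: "('a, 'n::finite) chart set"
    and g :: "('a, 'n) chart \<Rightarrow> real ^ 'n \<Rightarrow> real ^ 'n ^ 'n"
    and \<psi> :: "'a \<Rightarrow> real"
    and K N :: real
  assumes "smooth_manifold X A" and "compact_space X" and "connected_space X"
    and "CARD('n) \<ge> 2"
    and "riemannian_metric A g"
    and "smooth_fun A \<psi>"
    and "K > 0" and "N < 0"
    and "weighted_ricci_ge A g \<psi> N K"
  shows "ereal (K * N / (N - 1)) \<le> first_nonzero_eigenvalue X A g \<psi>"
  unfolding first_nonzero_eigenvalue_def
proof (rule INF_greatest)
  fix \<mu> assume "\<mu> \<in> {\<mu>. weighted_laplacian_eigenvalue X A g \<psi> \<mu> \<and> \<mu> \<noteq> 0}"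
  then obtain u where u: "smooth_fun A u" "\<exists>p\<in>topspace X. u p \<noteq> 0" "\<mu> \<noteq> 0"
    "\<And>c p. c \<in> A \<Longrightarrow> p \<in> fst c \<Longrightarrow>
       - weighted_laplacian (g c) (\<psi> \<circ> chart_inv c) (u \<circ> chart_inv c) (snd c p) = \<mu> * u p"
    unfolding weighted_laplacian_eigenvalue_def by blast
  interpret eigenfunction_on_compact_manifold X A g \<psi> u \<mu> K N
    by unfold_locales (use assms u in auto)
  show "ereal (K * N / (N - 1)) \<le> ereal \<mu>" using eigenvalue_ge by simp
qed

end
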